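(* Let $K$ be a field containing an element of multiplicative order $6$, and let \[G=(\mathrm{C}_3\times \mathrm{C}_3)\rtimes_{-1}\mathrm{C}_2=\langle a,b,c\mid a^3=b^3=c^2=1,\ ab=ba,\ cac^{-1}=a^{-1},\ cbc^{-1}=b^{-1}\rangle .\] Then $\beta_{\mathrm{sep}}^K(G)=6$.
   Context: Let $K$ be a field and $G$ a finite group with $\mathrm{char}(K)\nmid |G|$. For a finite dimensional $KG$-module $V$, $K[V]$ is the polynomial ring in the coordinate functions on $V$, on which $G$ acts by $(g\cdot f)(v)=f(g^{-1}v)$, and $K[V]^G$ is the subalgebra of $G$-invariants. A subset $S\subseteq K[V]^G$ is a separating set if whenever $v,w\in V$ have different $G$-orbits, there is $f\in S$ with $f(v)\ne f(w)$. The number $\beta_{\mathrm{sep}}(G,V)$ is the minimal positive integer $d$ such that the elements of $K[V]^G$ of degree at most $d$ form a separating set, and $\beta_{\mathrm{sep}}^K(G)$ is the supremum of $\beta_{\mathrm{sep}}(G,V)$ over all finite dimensional $KG$-modules $V$. *)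

theory Defs
  imports
    "HOL-Library.Poly_Mapping"
    "HOL-Library.Extended_Nat"
    "HOL-Algebra.Elementary_Groups"
    "HOL-Algebra.Group_Action"
    "Jordan_Normal_Form.Matrix"
begin

section \<open>Polynomials on a coordinate space\<close>

text \<open>Formal polynomials rather than polynomial functions: the field may be finite.
  A monomial is the finitely supported map sending the index of a variable to its exponent.\<close>

type_synonym 'k mpoly = "(nat \<Rightarrow>\<^sub>0 nat) \<Rightarrow>\<^sub>0 'k"

definition Const :: "'k::zero \<Rightarrow> 'k mpoly" where
  "Const c = Poly_Mapping.single 0 c"

definition Var :: "nat \<Rightarrow> 'k::zero_neq_one mpoly" where
  "Var i = Poly_Mapping.single (Poly_Mapping.single i 1) 1"

definition coord_ring :: "nat \<Rightarrow> 'k::zero mpoly set" where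
  "coord_ring n = {f. \<forall>m \<in> Poly_Mapping.keys f. Poly_Mapping.keys m \<subseteq> {..<n}}"

text \<open>Total degree, with the convention that the zero polynomial has degree 0.\<close>

definition total_degree :: "'k::zero mpoly \<Rightarrow> nat" where
  "total_degree f = Max (insert 0
     ((\<lambda>m. \<Sum>i\<in>Poly_Mapping.keys m. Poly_Mapping.lookup m i) ` Poly_Mapping.keys f))"

text \<open>Apply \<open>c\<close> to the coefficients and substitute \<open>x i\<close> for the variable of index \<open>i\<close>.\<close>

definition substitute :: "('k::zero \<Rightarrow> 'r::comm_semiring_1) \<Rightarrow> (nat \<Rightarrow> 'r) \<Rightarrow> 'k mpoly \<Rightarrow> 'r" where
  "substitute c x f = (\<Sum>m\<in>Poly_Mapping.keys f. c (Poly_Mapping.lookup f m) *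
     (\<Prod>i\<in>Poly_Mapping.keys m. x i ^ Poly_Mapping.lookup m i))"

definition eval_at :: "'k::comm_semiring_1 vec \<Rightarrow> 'k mpoly \<Rightarrow> 'k" where
  "eval_at v f = substitute (\<lambda>c. c) (\<lambda>i. v $ i) f"

text \<open>The polynomial \<open>f(A x)\<close>, i.e. the \<open>i\<close>-th variable is replaced by the \<open>i\<close>-th entry
  of the product of \<open>A\<close> with the column of variables.\<close>

definition compose_linear :: "'k::comm_semiring_1 mat \<Rightarrow> 'k mpoly \<Rightarrow> 'k mpoly" where
  "compose_linear A f =
     substitute Const (\<lambda>i. \<Sum>j<dim_col A. Const (A $$ (i, j)) * Var j) f"

section \<open>Modules, invariants and separating sets\<close>

text \<open>Up to isomorphism, a finite dimensional module over the group algebra is \<open>K\<^sup>n\<close> with an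
  action through matrices; \<open>n = 0\<close> is allowed.\<close>

definition matrix_rep :: "('g, 'b) monoid_scheme \<Rightarrow> nat \<Rightarrow> ('g \<Rightarrow> 'k::field mat) \<Rightarrow> bool" where
  "matrix_rep G n \<rho> \<longleftrightarrow>
     (\<forall>g \<in> carrier G. \<rho> g \<in> carrier_mat n n) \<and>
     \<rho> \<one>\<^bsub>G\<^esub> = 1\<^sub>m n \<and>
     (\<forall>g \<in> carrier G. \<forall>h \<in> carrier G. \<rho> (g \<otimes>\<^bsub>G\<^esub> h) = \<rho> g * \<rho> h)"

text \<open>The group acts on polynomials by \<open>(g \<cdot> f)(v) = f(g\<^sup>-\<^sup>1 v)\<close>.\<close>

definition poly_act ::
  "('g, 'b) monoid_scheme \<Rightarrow> ('g \<Rightarrow> 'k::field mat) \<Rightarrow> 'g \<Rightarrow> 'k mpoly \<Rightarrow> 'k mpoly" where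
  "poly_act G \<rho> g f = compose_linear (\<rho> (inv\<^bsub>G\<^esub> g)) f"

definition invariant_ring ::
  "('g, 'b) monoid_scheme \<Rightarrow> nat \<Rightarrow> ('g \<Rightarrow> 'k::field mat) \<Rightarrow> 'k mpoly set" where
  "invariant_ring G n \<rho> = {f \<in> coord_ring n. \<forall>g \<in> carrier G. poly_act G \<rho> g f = f}"

definition vec_orbit ::
  "('g, 'b) monoid_scheme \<Rightarrow> ('g \<Rightarrow> 'k::field mat) \<Rightarrow> 'k vec \<Rightarrow> 'k vec set" where
  "vec_orbit G \<rho> v = orbit G (\<lambda>g w. \<rho> g *\<^sub>v w) v"

definition separating_set ::
  "('g, 'b) monoid_scheme \<Rightarrow> nat \<Rightarrow> ('g \<Rightarrow> 'k::field mat) \<Rightarrow> 'k mpoly set \<Rightarrow> bool" where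
  "separating_set G n \<rho> S \<longleftrightarrow>
     S \<subseteq> invariant_ring G n \<rho> \<and>
     (\<forall>v \<in> carrier_vec n. \<forall>w \<in> carrier_vec n.
        vec_orbit G \<rho> v \<noteq> vec_orbit G \<rho> w \<longrightarrow> (\<exists>f \<in> S. eval_at v f \<noteq> eval_at w f))"

text \<open>The infimum is the minimum; it is taken in \<open>enat\<close> so that it would be \<open>\<infinity>\<close>, not an
  unspecified number, if no degree bound sufficed. Likewise for the supremum over all modules.\<close>

definition beta_sep_rep ::
  "('g, 'b) monoid_scheme \<Rightarrow> nat \<Rightarrow> ('g \<Rightarrow> 'k::field mat) \<Rightarrow> enat" where
  "beta_sep_rep G n \<rho> = Inf (enat ` {d. 0 < d \<and>
     separating_set G n \<rho> {f \<in> invariant_ring G n \<rho>. total_degree f \<le> d}})"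

definition beta_sep :: "'k::field itself \<Rightarrow> ('g, 'b) monoid_scheme \<Rightarrow> enat" where
  "beta_sep _ G = Sup {beta_sep_rep G n \<rho> | n (\<rho> :: 'g \<Rightarrow> 'k mat). matrix_rep G n \<rho>}"

section \<open>The group\<close>

definition semidirect_product ::
  "('n, 'a) monoid_scheme \<Rightarrow> ('h, 'b) monoid_scheme \<Rightarrow> ('h \<Rightarrow> 'n \<Rightarrow> 'n) \<Rightarrow> ('n \<times> 'h) monoid" where
  "semidirect_product N H \<phi> = \<lparr>carrier = carrier N \<times> carrier H,
     monoid.mult = (\<lambda>(x, h) (y, k). (x \<otimes>\<^bsub>N\<^esub> \<phi> h y, h \<otimes>\<^bsub>H\<^esub> k)),
     one = (\<one>\<^bsub>N\<^esub>, \<one>\<^bsub>H\<^esub>)\<rparr>"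

abbreviation C3xC3 :: "(int \<times> int) monoid" where
  "C3xC3 \<equiv> integer_mod_group 3 \<times>\<times> integer_mod_group 3"

definition C3xC3_rtimes_C2 :: "((int \<times> int) \<times> int) monoid" where
  "C3xC3_rtimes_C2 = semidirect_product C3xC3 (integer_mod_group 2)
     (\<lambda>h x. if h = 0 then x else inv\<^bsub>C3xC3\<^esub> x)"

text \<open>The remaining lemmas confirm that this is the group presented by
  \<open>\<langle>a, b, c | a\<^sup>3 = b\<^sup>3 = c\<^sup>2 = 1, ab = ba, cac\<^sup>-\<^sup>1 = a\<^sup>-\<^sup>1, cbc\<^sup>-\<^sup>1 = b\<^sup>-\<^sup>1\<rangle>\<close>: the relations
  allow at most the 18 elements \<open>a\<^sup>i b\<^sup>j c\<^sup>k\<close>.\<close>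

lemma carrier_C3xC3_rtimes_C2:
  "carrier C3xC3_rtimes_C2 = ({0,1,2} \<times> {0,1,2}) \<times> {0,1}"
proof -
  have "{0..<3} = {0,1,2::int}" "{0..<2} = {0,1::int}" by auto
  then show ?thesis
    by (simp add: C3xC3_rtimes_C2_def semidirect_product_def DirProd_def carrier_integer_mod_group)
qed

lemma one_C3xC3_rtimes_C2: "\<one>\<^bsub>C3xC3_rtimes_C2\<^esub> = ((0,0),0)"
  by (simp add: C3xC3_rtimes_C2_def semidirect_product_def DirProd_def)

lemma mult_C3xC3_rtimes_C2:
  assumes "i' \<in> {0,1,2}" "j' \<in> {0,1,2}"
  shows "((i,j),k) \<otimes>\<^bsub>C3xC3_rtimes_C2\<^esub> ((i',j'),k') =
    (if k = 0 then ((i + i') mod 3, (j + j') mod 3) else ((i - i') mod 3, (j - j') mod 3),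
     (k + k') mod 2)"
proof -
  have "inv\<^bsub>C3xC3\<^esub> (i',j') = ((- i') mod 3, (- j') mod 3)"
    using assms by (subst inv_DirProd) (auto simp: carrier_integer_mod_group)
  then show ?thesis
    by (auto simp: C3xC3_rtimes_C2_def semidirect_product_def DirProd_def mod_simps)
qed

lemma order_C3xC3_rtimes_C2: "order C3xC3_rtimes_C2 = 18"
  by (simp add: order_def carrier_C3xC3_rtimes_C2 card_cartesian_product)

lemma mod_in: "m mod 3 \<in> {0,1,2}" "m mod 2 \<in> {0,1}" for m :: int
  by (simp; presburger)+

lemma group_C3xC3_rtimes_C2: "group C3xC3_rtimes_C2"
proof (rule groupI)
  fix x y z
  assume "x \<in> carrier C3xC3_rtimes_C2" "y \<in> carrier C3xC3_rtimes_C2"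
    "z \<in> carrier C3xC3_rtimes_C2"
  then obtain i j k i' j' k' i'' j'' k''
    where xyz: "x = ((i,j),k)" "y = ((i',j'),k')" "z = ((i'',j''),k'')"
      and *: "i' \<in> {0,1,2}" "j' \<in> {0,1,2}" "i'' \<in> {0,1,2}" "j'' \<in> {0,1,2}"
      and k: "k \<in> {0,1}" "k' \<in> {0,1}"
    unfolding carrier_C3xC3_rtimes_C2 by (elim SigmaE) simp
  show "x \<otimes>\<^bsub>C3xC3_rtimes_C2\<^esub> y \<otimes>\<^bsub>C3xC3_rtimes_C2\<^esub> z =
      x \<otimes>\<^bsub>C3xC3_rtimes_C2\<^esub> (y \<otimes>\<^bsub>C3xC3_rtimes_C2\<^esub> z)"
    using k(1)
    by (elim insertE emptyE; insert k(2); elim insertE emptyE)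
      (simp_all only: xyz mult_C3xC3_rtimes_C2[OF *(1,2)] mult_C3xC3_rtimes_C2[OF *(3,4)]
        mult_C3xC3_rtimes_C2[OF mod_in(1) mod_in(1)] if_True if_False refl one_neq_zero
        add_0_left add_0_right one_add_one mod_0 mod_self one_mod_two_eq_one,
       simp_all add: mod_simps, simp_all add: algebra_simps)
next
  fix x y
  assume "x \<in> carrier C3xC3_rtimes_C2" "y \<in> carrier C3xC3_rtimes_C2"
  then obtain i j k i' j' k' where "x = ((i,j),k)" "y = ((i',j'),k')"
      and "i' \<in> {0,1,2}" "j' \<in> {0,1,2}"
    unfolding carrier_C3xC3_rtimes_C2 by (elim SigmaE) simp
  then show "x \<otimes>\<^bsub>C3xC3_rtimes_C2\<^esub> y \<in> carrier C3xC3_rtimes_C2"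
    by (simp only: mult_C3xC3_rtimes_C2 carrier_C3xC3_rtimes_C2 split: if_split)
      (intro conjI impI SigmaI mod_in)
next
  fix x assume "x \<in> carrier C3xC3_rtimes_C2"
  then obtain i j k where x: "x = ((i,j),k)"
    and ijk: "i \<in> {0,1,2}" "j \<in> {0,1,2}" "k \<in> {0,1}"
    by (auto simp: carrier_C3xC3_rtimes_C2)
  define y where "y = (if k = 0 then (((- i) mod 3, (- j) mod 3), 0) else x)"
  have "y \<in> carrier C3xC3_rtimes_C2"
    "y \<otimes>\<^bsub>C3xC3_rtimes_C2\<^esub> x = \<one>\<^bsub>C3xC3_rtimes_C2\<^esub>"
    using ijk unfolding y_def x carrier_C3xC3_rtimes_C2 one_C3xC3_rtimes_C2
    by (elim insertE emptyE; simp add: mult_C3xC3_rtimes_C2)+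
  then show "\<exists>y\<in>carrier C3xC3_rtimes_C2. y \<otimes>\<^bsub>C3xC3_rtimes_C2\<^esub> x = \<one>\<^bsub>C3xC3_rtimes_C2\<^esub>"
    by blast
qed (auto simp: carrier_C3xC3_rtimes_C2 one_C3xC3_rtimes_C2 mult_C3xC3_rtimes_C2)

lemma presentation_C3xC3_rtimes_C2:
  fixes G (structure)
  defines "G \<equiv> C3xC3_rtimes_C2"
    and "a \<equiv> ((1,0),0)" and "b \<equiv> ((0,1),0)" and "c \<equiv> ((0,0),1)"
  shows "a [^] (3::nat) = \<one>" "b [^] (3::nat) = \<one>" "c [^] (2::nat) = \<one>"
    and "a \<otimes> b = b \<otimes> a"
    and "c \<otimes> a \<otimes> inv c = inv a" "c \<otimes> b \<otimes> inv c = inv b"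
    and "generate G {a, b, c} = carrier G"
proof -
  interpret group G unfolding G_def by (rule group_C3xC3_rtimes_C2)
  note rules = G_def carrier_C3xC3_rtimes_C2 one_C3xC3_rtimes_C2 mult_C3xC3_rtimes_C2
  note abc = a_def b_def c_def
  have G: "a \<in> carrier G" "b \<in> carrier G" "c \<in> carrier G"
    by (auto simp: abc rules)
  show "a [^] (3::nat) = \<one>" "b [^] (3::nat) = \<one>" "c [^] (2::nat) = \<one>"
    by (simp_all add: abc rules nat_pow_def numeral_eq_Suc)
  show "a \<otimes> b = b \<otimes> a"
    by (simp add: abc rules)
  have inv: "inv a = ((2,0),0)" "inv b = ((0,2),0)" "inv c = c"
    by (rule inv_equality; simp add: abc rules)+
  show "c \<otimes> a \<otimes> inv c = inv a" "c \<otimes> b \<otimes> inv c = inv b"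
    unfolding inv by (simp_all add: abc rules)
  have "x \<in> generate G {a, b, c}" if x_in: "x \<in> carrier G" for x
  proof -
    have gen: "a \<in> generate G {a, b, c}" "b \<in> generate G {a, b, c}" "c \<in> generate G {a, b, c}"
      "\<one> \<in> generate G {a, b, c}"
      by (auto intro: generate.incl generate.one)
    obtain i j k where x: "x = ((i,j),k)" and ijk: "i \<in> {0,1,2}" "j \<in> {0,1,2}" "k \<in> {0,1}"
      using x_in by (auto simp: rules)
    have "((i,0),0) \<in> generate G {a, b, c}"
      using ijk(1) gen(1,4) generate.eng[OF gen(1,1)] by (auto simp: abc rules)
    moreover have "((0,j),0) \<in> generate G {a, b, c}"
      using ijk(2) gen(2,4) generate.eng[OF gen(2,2)] by (auto simp: abc rules)
    moreover have "((0,0),k) \<in> generate G {a, b, c}"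
      using ijk(3) gen(3,4) by (auto simp: abc rules)
    ultimately have "((i,0),0) \<otimes> ((0,j),0) \<otimes> ((0,0),k) \<in> generate G {a, b, c}"
      by (intro generate.eng)
    then show ?thesis
      using ijk by (auto simp: x rules)
  qed
  then show "generate G {a, b, c} = carrier G"
    using generate_in_carrier[of "{a, b, c}"] G by blast
qed

end

theory Submission
  imports Defs
begin

text \<open>Let \<open>N\<close> be the normal subgroup \<open>C\<^sub>3 \<times> C\<^sub>3\<close>; its characters take values in \<open>K\<close>.
  An \<open>N\<close>-invariant \<open>f\<close> of degree at most six gives the \<open>G\<close>-invariant \<open>f + c f\<close>. Since
  \<open>(f - c f) (g - c g)\<close> is \<open>G\<close>-invariant, two points \<open>v\<close>, \<open>w\<close> not separated in degree at most six agree
  on all \<open>N\<close>-invariants of degree at most three, after replacing \<open>w\<close> by \<open>c w\<close> if necessary.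
  They then agree on \<open>m = x y z\<^sup>2\<close>, for \<open>x\<close>, \<open>y\<close>, \<open>z\<close> linear forms that are \<open>N\<close>-eigenvectors and
  \<open>m\<close> \<open>N\<close>-invariant: if \<open>z\<close> vanishes then so does \<open>m\<close>, if \<open>c z\<close> vanishes then \<open>m = m + c m\<close>, and otherwise
  \<open>m (z c z) = (x y c z) z\<^sup>3\<close> with all other factors invariant of degree at most three. These
  monomials determine the point up to \<open>N\<close>, because a character of the group of weights is
  determined by its values on two independent weights.

  For the lower bound take the sum of two of the two-dimensional irreducible modules, with
  coordinates \<open>x\<^sub>1, y\<^sub>1, x\<^sub>2, y\<^sub>2\<close>, and the points \<open>(1,0,1,0)\<close> and \<open>(1,0,0,1)\<close>. An \<open>N\<close>-invariant
  monomial in \<open>x\<^sub>1, x\<^sub>2\<close> or in \<open>x\<^sub>1, y\<^sub>2\<close> has exponents divisible by three, so in degree at most five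
  it involves a single variable and cannot see how the two summands are coupled.\<close>

section \<open>Substitution into polynomials\<close>

abbreviation monom_val :: "(nat \<Rightarrow> 'r::comm_monoid_mult) \<Rightarrow> (nat \<Rightarrow>\<^sub>0 nat) \<Rightarrow> 'r" where
  "monom_val x m \<equiv> \<Prod>i\<in>Poly_Mapping.keys m. x i ^ Poly_Mapping.lookup m i"

abbreviation monom_deg :: "(nat \<Rightarrow>\<^sub>0 nat) \<Rightarrow> nat" where
  "monom_deg m \<equiv> \<Sum>i\<in>Poly_Mapping.keys m. Poly_Mapping.lookup m i"

lemma monom_val_superset:
  assumes "finite I" "Poly_Mapping.keys m \<subseteq> I"
  shows "monom_val x m = (\<Prod>i\<in>I. x i ^ Poly_Mapping.lookup m i)"
  using assms by (intro prod.mono_neutral_left) (auto simp: in_keys_iff)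

lemma monom_deg_superset:
  assumes "finite I" "Poly_Mapping.keys m \<subseteq> I"
  shows "monom_deg m = (\<Sum>i\<in>I. Poly_Mapping.lookup m i)"
  using assms by (intro sum.mono_neutral_left) (auto simp: in_keys_iff)

lemma monom_val_add: "monom_val x (m + m') = monom_val x m * monom_val x m'"
proof -
  let ?I = "Poly_Mapping.keys m \<union> Poly_Mapping.keys m'"
  have "monom_val x (m + m') = (\<Prod>i\<in>?I. x i ^ Poly_Mapping.lookup (m + m') i)"
    using Poly_Mapping.keys_add[of m m'] by (intro monom_val_superset) auto
  then show ?thesis
    by (subst (1 2) monom_val_superset[of ?I]) (auto simp: lookup_add power_add prod.distrib)
qed

lemma monom_deg_add: "monom_deg (m + m') = monom_deg m + monom_deg m'"
proof -
  let ?I = "Poly_Mapping.keys m \<union> Poly_Mapping.keys m'"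
  have "monom_deg (m + m') = (\<Sum>i\<in>?I. Poly_Mapping.lookup (m + m') i)"
    using Poly_Mapping.keys_add[of m m'] by (intro monom_deg_superset) auto
  then show ?thesis
    by (subst (1 2) monom_deg_superset[of ?I]) (auto simp: lookup_add sum.distrib)
qed

lemma poly_mapping_eq_sum_single:
  "f = (\<Sum>m\<in>Poly_Mapping.keys f. Poly_Mapping.single m (Poly_Mapping.lookup f m))"
  by (rule poly_mapping_eqI)
    (simp add: lookup_sum lookup_single when_def in_keys_iff sum.delta)

text \<open>Substitution respects sums and products as soon as the coefficient map is a semiring
  homomorphism, and is then one itself. So \<open>Const\<close>, \<open>eval_at v\<close> and
  \<open>compose_linear A\<close> all draw on this one locale.\<close>

locale coeff_hom =
  fixes c :: "'k::comm_semiring_1 \<Rightarrow> 'r::comm_semiring_1"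
  assumes hom_0: "c 0 = 0" and hom_1: "c 1 = 1"
    and hom_add: "c (a + b) = c a + c b" and hom_mult: "c (a * b) = c a * c b"
begin

lemma hom_sum: "c (sum f I) = (\<Sum>i\<in>I. c (f i))"
  by (induction I rule: infinite_finite_induct) (auto simp: hom_0 hom_add)

lemma hom_power: "c (a ^ k) = c a ^ k"
  by (induction k) (auto simp: hom_1 hom_mult)

lemma hom_prod: "c (prod f I) = (\<Prod>i\<in>I. c (f i))"
  by (induction I rule: infinite_finite_induct) (auto simp: hom_1 hom_mult)

lemma substitute_superset:
  assumes "finite M" "Poly_Mapping.keys f \<subseteq> M"
  shows "substitute c x f = (\<Sum>m\<in>M. c (Poly_Mapping.lookup f m) * monom_val x m)"
  unfolding substitute_def using assms
  by (intro sum.mono_neutral_left) (auto simp: in_keys_iff hom_0)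

lemma substitute_single: "substitute c x (Poly_Mapping.single m a) = c a * monom_val x m"
  by (subst substitute_superset[of "{m}"]) auto

lemma substitute_add: "substitute c x (f + g) = substitute c x f + substitute c x g"
proof -
  let ?M = "Poly_Mapping.keys f \<union> Poly_Mapping.keys g"
  have "substitute c x (f + g) = (\<Sum>m\<in>?M. c (Poly_Mapping.lookup (f + g) m) * monom_val x m)"
    using Poly_Mapping.keys_add[of f g] by (intro substitute_superset) auto
  then show ?thesis
    by (subst (1 2) substitute_superset[of ?M])
      (auto simp: lookup_add hom_add sum.distrib distrib_right)
qed

lemma substitute_0: "substitute c x 0 = 0"
  by (simp add: substitute_def)

lemma substitute_sum: "substitute c x (sum f I) = (\<Sum>i\<in>I. substitute c x (f i))"
  by (induction I rule: infinite_finite_induct) (auto simp: substitute_0 substitute_add)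

lemma substitute_mult: "substitute c x (f * g) = substitute c x f * substitute c x g"
proof -
  let ?s = "\<lambda>f. \<Sum>m\<in>Poly_Mapping.keys f. Poly_Mapping.single m (Poly_Mapping.lookup f m)"
  have "substitute c x (?s f * ?s g) = substitute c x (?s f) * substitute c x (?s g)"
    by (simp add: sum_product substitute_sum mult_single substitute_single hom_mult
        monom_val_add mult_ac)
  then show ?thesis
    by (simp only: poly_mapping_eq_sum_single[symmetric])
qed

lemma substitute_Const: "substitute c x (Const a) = c a"
  by (simp add: Const_def substitute_single)

lemma substitute_Var: "substitute c x (Var i) = x i"
  by (simp add: Var_def substitute_single hom_1)

lemma coeff_hom_substitute: "coeff_hom (substitute c x)"
  by unfold_locales
    (auto simp: substitute_0 substitute_add substitute_mult substitute_single hom_1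
      simp flip: single_one)

end

lemma coeff_hom_id: "coeff_hom (\<lambda>c. c)"
  by unfold_locales auto

lemma coeff_hom_Const: "coeff_hom Const"
  by unfold_locales (auto simp: Const_def single_add mult_single)

lemma (in coeff_hom) hom_substitute:
  "c (substitute d x f) = substitute (\<lambda>a. c (d a)) (\<lambda>i. c (x i)) f"
  by (simp add: substitute_def hom_sum hom_mult hom_prod hom_power)

text \<open>Entries of vectors and matrices beyond the dimension are unspecified, so substitutions
  may only be compared at indices below \<open>n\<close>.\<close>

lemma substitute_cong:
  assumes "f \<in> coord_ring n" "\<And>i. i < n \<Longrightarrow> x i = y i"
  shows "substitute c x f = substitute c y f"
proof -
  have "monom_val x m = monom_val y m" if "m \<in> Poly_Mapping.keys f" for m
    using assms that by (intro prod.cong arg_cong2[of _ _ _ _ "(^)"]) (auto simp: coord_ring_def)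
  then show ?thesis by (simp add: substitute_def)
qed

section \<open>Polynomials of bounded degree\<close>

definition polys_upto :: "nat \<Rightarrow> nat \<Rightarrow> 'k::zero mpoly set" where
  "polys_upto n d = {f \<in> coord_ring n. total_degree f \<le> d}"

lemma polys_upto_iff:
  "f \<in> polys_upto n d \<longleftrightarrow> (\<forall>m\<in>Poly_Mapping.keys f. Poly_Mapping.keys m \<subseteq> {..<n} \<and> monom_deg m \<le> d)"
  by (auto simp: polys_upto_def coord_ring_def total_degree_def)

lemma polys_upto_mono: "d \<le> e \<Longrightarrow> f \<in> polys_upto n d \<Longrightarrow> f \<in> polys_upto n e"
  by (simp add: polys_upto_def)

lemma polys_upto_0: "0 \<in> polys_upto n d"
  by (simp add: polys_upto_iff)

lemma polys_upto_add: "f \<in> polys_upto n d \<Longrightarrow> g \<in> polys_upto n d \<Longrightarrow> f + g \<in> polys_upto n d"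
  using Poly_Mapping.keys_add[of f g] by (auto simp: polys_upto_iff)

lemma polys_upto_sum: "(\<And>i. i \<in> I \<Longrightarrow> f i \<in> polys_upto n d) \<Longrightarrow> sum f I \<in> polys_upto n d"
  by (induction I rule: infinite_finite_induct) (auto simp: polys_upto_0 polys_upto_add)

lemma polys_upto_mult:
  assumes "f \<in> polys_upto n d" "g \<in> polys_upto n e"
  shows "f * g \<in> polys_upto n (d + e)"
  unfolding polys_upto_iff
proof
  fix m assume "m \<in> Poly_Mapping.keys (f * g)"
  then obtain a b where m: "m = a + b" and "a \<in> Poly_Mapping.keys f" "b \<in> Poly_Mapping.keys g"
    using Poly_Mapping.keys_mult[of f g] by blast
  then show "Poly_Mapping.keys m \<subseteq> {..<n} \<and> monom_deg m \<le> d + e"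
    unfolding m monom_deg_add using assms Poly_Mapping.keys_add[of a b]
    by (fastforce simp: polys_upto_iff intro: add_mono)
qed

lemma Const_in_polys_upto: "Const a \<in> polys_upto n 0"
  by (auto simp: polys_upto_iff Const_def)

lemma one_in_polys_upto: "1 \<in> polys_upto n d"
  by (auto simp: polys_upto_iff)

lemma Var_in_polys_upto: "i < n \<Longrightarrow> Var i \<in> polys_upto n 1"
  by (auto simp: polys_upto_iff Var_def)

lemma polys_upto_power:
  assumes "f \<in> polys_upto n d"
  shows "f ^ k \<in> polys_upto n (k * d)"
proof (induction k)
  case 0
  show ?case by (simp add: one_in_polys_upto)
next
  case (Suc k)
  then show ?case using polys_upto_mult[OF assms Suc] by simp
qed

lemma polys_upto_prod:
  assumes "\<And>i. i \<in> I \<Longrightarrow> f i \<in> polys_upto n (d i)"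
  shows "prod f I \<in> polys_upto n (sum d I)"
  using assms
proof (induction I rule: infinite_finite_induct)
  case (insert i I)
  then show ?case using polys_upto_mult[of "f i" n "d i"] by simp
qed (auto simp: one_in_polys_upto)

lemma substitute_in_polys_upto:
  assumes f: "f \<in> polys_upto n d" and x: "\<And>i. i < n \<Longrightarrow> x i \<in> polys_upto n 1"
  shows "substitute Const x f \<in> polys_upto n d"
  unfolding substitute_def
proof (rule polys_upto_sum)
  fix m assume m: "m \<in> Poly_Mapping.keys f"
  have "monom_val x m \<in> polys_upto n (monom_deg m)"
  proof (rule polys_upto_prod)
    fix i assume "i \<in> Poly_Mapping.keys m"
    then have "i < n" using f m by (auto simp: polys_upto_iff)
    then show "x i ^ Poly_Mapping.lookup m i \<in> polys_upto n (Poly_Mapping.lookup m i)"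
      using polys_upto_power[OF x] by fastforce
  qed
  then have "Const (Poly_Mapping.lookup f m) * monom_val x m \<in> polys_upto n (0 + monom_deg m)"
    by (rule polys_upto_mult[OF Const_in_polys_upto])
  then show "Const (Poly_Mapping.lookup f m) * monom_val x m \<in> polys_upto n d"
    by (rule polys_upto_mono[rotated]) (use f m in \<open>auto simp: polys_upto_iff\<close>)
qed

section \<open>Linear changes of variables\<close>

interpretation id: coeff_hom "\<lambda>c. c"
  by (rule coeff_hom_id)

interpretation Const: coeff_hom Const
  by (rule coeff_hom_Const)

interpretation eval_at: coeff_hom "eval_at v" for v
  unfolding eval_at_def by (rule id.coeff_hom_substitute)

interpretation compose_linear: coeff_hom "compose_linear A" for A
  unfolding compose_linear_def by (rule Const.coeff_hom_substitute)

lemma eval_at_Const [simp]: "eval_at v (Const a) = a"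
  by (simp add: eval_at_def id.substitute_Const)

lemma eval_at_Var [simp]: "eval_at v (Var i) = v $ i"
  by (simp add: eval_at_def id.substitute_Var)

lemma compose_linear_Const [simp]: "compose_linear A (Const a) = Const a"
  by (simp add: compose_linear_def Const.substitute_Const)

lemma compose_linear_Var [simp]:
  "compose_linear A (Var i) = (\<Sum>j<dim_col A. Const (A $$ (i, j)) * Var j)"
  by (simp add: compose_linear_def Const.substitute_Var)

lemma eval_at_compose_linear:
  assumes "A \<in> carrier_mat n n" "v \<in> carrier_vec n" "f \<in> coord_ring n"
  shows "eval_at v (compose_linear A f) = eval_at (A *\<^sub>v v) f"
proof -
  have "eval_at v (compose_linear A f) =
      substitute (\<lambda>a. a) (\<lambda>i. \<Sum>j<dim_col A. A $$ (i, j) * v $ j) f"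
    by (simp add: compose_linear_def eval_at.hom_substitute eval_at.hom_sum eval_at.hom_mult)
  also have "\<dots> = eval_at (A *\<^sub>v v) f"
    unfolding eval_at_def using assms
    by (intro substitute_cong[OF assms(3)])
      (auto simp: scalar_prod_def atLeast0LessThan intro!: sum.cong)
  finally show ?thesis .
qed

text \<open>Replacing x by B x in f(A x) gives f(A B x), whence the reversed order.\<close>

lemma compose_linear_compose_linear:
  assumes "A \<in> carrier_mat n n" "B \<in> carrier_mat n n" "f \<in> coord_ring n"
  shows "compose_linear B (compose_linear A f) = compose_linear (A * B) f"
proof -
  have "compose_linear B (compose_linear A f) =
      substitute Const (\<lambda>i. \<Sum>j<n. Const (A $$ (i, j)) * (\<Sum>k<n. Const (B $$ (j, k)) * Var k)) f"
    using assms
    by (simp add: compose_linear_def[of A] compose_linear.hom_substitute compose_linear.hom_sum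
        compose_linear.hom_mult)
  also have "\<dots> = compose_linear (A * B) f"
    unfolding compose_linear_def using assms
  proof (intro substitute_cong[OF assms(3)])
    fix i assume i: "i < n"
    have "(\<Sum>j<n. Const (A $$ (i, j)) * (\<Sum>k<n. Const (B $$ (j, k)) * Var k)) =
        (\<Sum>k<n. (\<Sum>j<n. Const (A $$ (i, j)) * Const (B $$ (j, k))) * Var k)"
      by (simp add: sum_distrib_left sum_distrib_right mult.assoc) (rule sum.swap)
    also have "\<dots> = (\<Sum>j<dim_col (A * B). Const ((A * B) $$ (i, j)) * Var j)"
      using assms i
      by (intro sum.cong)
        (auto simp: scalar_prod_def Const.hom_sum Const.hom_mult atLeast0LessThan intro!: sum.cong)
    finally show "(\<Sum>j<n. Const (A $$ (i, j)) * (\<Sum>k<n. Const (B $$ (j, k)) * Var k)) =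
        (\<Sum>j<dim_col (A * B). Const ((A * B) $$ (i, j)) * Var j)" .
  qed
  finally show ?thesis .
qed

lemma compose_linear_in_polys_upto:
  assumes "A \<in> carrier_mat n n" "f \<in> polys_upto n d"
  shows "compose_linear A f \<in> polys_upto n d"
  unfolding compose_linear_def
proof (rule substitute_in_polys_upto[OF assms(2)])
  fix i
  have "Const (A $$ (i, j)) * Var j \<in> polys_upto n (0 + 1)" if "j < n" for j
    using that by (intro polys_upto_mult Const_in_polys_upto Var_in_polys_upto)
  then show "(\<Sum>j<dim_col A. Const (A $$ (i, j)) * Var j) \<in> polys_upto n 1"
    using assms by (intro polys_upto_sum) auto
qed

section \<open>Linear forms and the transposed action on their coefficients\<close>

definition linear_form :: "nat \<Rightarrow> 'k::comm_semiring_1 vec \<Rightarrow> 'k mpoly" where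
  "linear_form n u = (\<Sum>i<n. Const (u $ i) * Var i)"

lemma linear_form_in_polys_upto: "linear_form n u \<in> polys_upto n 1"
proof -
  have "Const (u $ i) * Var i \<in> polys_upto n (0 + 1)" if "i < n" for i
    using that by (intro polys_upto_mult Const_in_polys_upto Var_in_polys_upto)
  then show ?thesis
    unfolding linear_form_def by (intro polys_upto_sum) auto
qed

lemma eval_at_linear_form:
  "v \<in> carrier_vec n \<Longrightarrow> eval_at v (linear_form n u) = u \<bullet> v"
  by (auto simp: linear_form_def eval_at.hom_sum eval_at.hom_mult scalar_prod_def atLeast0LessThan)

lemma linear_form_smult:
  "u \<in> carrier_vec n \<Longrightarrow> linear_form n (a \<cdot>\<^sub>v u) = Const a * linear_form n u"
  by (simp add: linear_form_def Const.hom_mult sum_distrib_left mult.assoc)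

lemma compose_linear_linear_form:
  assumes "A \<in> carrier_mat n n" "u \<in> carrier_vec n"
  shows "compose_linear A (linear_form n u) = linear_form n (transpose_mat A *\<^sub>v u)"
proof -
  have "compose_linear A (linear_form n u) =
      (\<Sum>i<n. Const (u $ i) * (\<Sum>j<n. Const (A $$ (i, j)) * Var j))"
    using assms by (simp add: linear_form_def compose_linear.hom_sum compose_linear.hom_mult)
  also have "\<dots> = (\<Sum>j<n. (\<Sum>i<n. Const (A $$ (i, j)) * Const (u $ i)) * Var j)"
    by (simp add: sum_distrib_left sum_distrib_right mult_ac) (rule sum.swap)
  also have "\<dots> = linear_form n (transpose_mat A *\<^sub>v u)"
    unfolding linear_form_def using assms
    by (intro sum.cong)
      (auto simp: scalar_prod_def Const.hom_sum Const.hom_mult atLeast0LessThan intro!: sum.cong)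
  finally show ?thesis .
qed

section \<open>Reduction to a concrete group\<close>

text \<open>Inversion permutes the group, so quantifying over all elements removes the inverse from
  the action.\<close>

lemma invariant_ring_iff:
  assumes "group G"
  shows "f \<in> invariant_ring G n \<rho> \<longleftrightarrow>
    f \<in> coord_ring n \<and> (\<forall>g\<in>carrier G. compose_linear (\<rho> g) f = f)"
  using group.inv_closed[OF assms] group.inv_inv[OF assms]
  unfolding invariant_ring_def poly_act_def by (smt (verit) mem_Collect_eq)

lemma vec_orbit_eq_image: "vec_orbit G \<rho> v = (\<lambda>M. M *\<^sub>v v) ` \<rho> ` carrier G"
  by (auto simp: vec_orbit_def orbit_def)

text \<open>Invariants and orbits depend only on the set of matrices by which the group acts. This
  lets modules be transported along isomorphisms of groups.\<close>

lemma beta_sep_rep_image: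
  assumes "group G" "group H" "\<rho> ` carrier G = \<sigma> ` carrier H"
  shows "beta_sep_rep G n \<rho> = beta_sep_rep H n \<sigma>"
proof -
  have "invariant_ring G n \<rho> = invariant_ring H n \<sigma>"
  proof -
    have "(\<forall>g\<in>carrier G. compose_linear (\<rho> g) f = f) \<longleftrightarrow>
        (\<forall>M\<in>\<rho> ` carrier G. compose_linear M f = f)" for f by blast
    moreover have "(\<forall>g\<in>carrier H. compose_linear (\<sigma> g) f = f) \<longleftrightarrow>
        (\<forall>M\<in>\<sigma> ` carrier H. compose_linear M f = f)" for f by blast
    ultimately show ?thesis
      unfolding set_eq_iff invariant_ring_iff[OF assms(1)] invariant_ring_iff[OF assms(2)] assms(3)
      by blast
  qed
  moreover have "vec_orbit G \<rho> = vec_orbit H \<sigma>"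
    using assms(3) by (intro ext) (simp add: vec_orbit_eq_image)
  ultimately show ?thesis
    by (simp add: beta_sep_rep_def separating_set_def)
qed

lemma matrix_rep_iso:
  assumes "h \<in> iso H G" "matrix_rep G n \<rho>" "group G" "group H"
  shows "matrix_rep H n (\<lambda>x. \<rho> (h x))" "\<rho> ` carrier G = (\<lambda>x. \<rho> (h x)) ` carrier H"
proof -
  interpret group_hom H G h
    using assms by (simp add: group_hom_def group_hom_axioms_def iso_def)
  show "matrix_rep H n (\<lambda>x. \<rho> (h x))"
    using assms(2) by (simp add: matrix_rep_def)
  show "\<rho> ` carrier G = (\<lambda>x. \<rho> (h x)) ` carrier H"
    using assms(1) by (auto simp: iso_def bij_betw_def image_image[symmetric])
qed

lemma beta_sep_le_iso:
  assumes "G \<cong> H" "group G" "group H"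
  shows "beta_sep TYPE('k::field) G \<le> beta_sep TYPE('k) H"
  unfolding beta_sep_def
proof (rule Sup_least, elim CollectE exE conjE)
  fix x n and \<rho> :: "_ \<Rightarrow> 'k mat"
  assume x: "x = beta_sep_rep G n \<rho>" and \<rho>: "matrix_rep G n \<rho>"
  obtain h where h: "h \<in> iso H G"
    using group.iso_sym[OF assms(2,1)] by (auto simp: is_iso_def)
  note * = matrix_rep_iso[OF h \<rho> assms(2,3)]
  have "x = beta_sep_rep H n (\<lambda>x. \<rho> (h x))"
    unfolding x by (rule beta_sep_rep_image[OF assms(2,3) *(2)])
  with *(1) show "x \<le> Sup {beta_sep_rep H n \<rho> |n \<rho> :: _ \<Rightarrow> 'k mat. matrix_rep H n \<rho>}"
    by (intro Sup_upper) auto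
qed

lemma beta_sep_iso:
  assumes "G \<cong> H" "group G" "group H"
  shows "beta_sep TYPE('k::field) G = beta_sep TYPE('k) H"
  using assms group.iso_sym[OF assms(2,1)] by (intro antisym beta_sep_le_iso)

section \<open>Cube roots of unity\<close>

lemma mod_3_cases: fixes k :: int obtains "k mod 3 = 0" | "k mod 3 = 1" | "k mod 3 = 2"
proof -
  have "k mod 3 = 0 \<or> k mod 3 = 1 \<or> k mod 3 = 2" by presburger
  with that show thesis by blast
qed

text \<open>The condition \<open>two_neq_0\<close> permits the halving that recovers an invariant
  from its symmetric and antisymmetric parts under \<open>C\<close>.\<close>

locale cube_root =
  fixes \<omega> :: "'k::field"
  assumes cube: "\<omega> ^ 3 = 1" and neq_1: "\<omega> \<noteq> 1" and two_neq_0: "(2::'k) \<noteq> 0"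
begin

text \<open>The character of the integers modulo three that sends 1 to \<open>\<omega>\<close>,
  pulled back to all integers so that weights can be added and negated without reduction.\<close>

definition e :: "int \<Rightarrow> 'k" where
  "e k = \<omega> ^ nat (k mod 3)"

lemma omega_sum: "1 + \<omega> + \<omega> * \<omega> = 0"
proof -
  have "(\<omega> - 1) * (1 + \<omega> + \<omega> * \<omega>) = \<omega> ^ 3 - 1"
    by (simp add: algebra_simps power3_eq_cube)
  then show ?thesis using cube neq_1 by simp
qed

text \<open>In characteristic three, 1 + X + X^2 is the square of X - 1, so 1 would be the only cube
  root of unity.\<close>

lemma three_neq_0: "(3::'k) \<noteq> 0"
proof
  assume "(3::'k) = 0"
  have "(\<omega> - 1) * (\<omega> - 1) = (1 + \<omega> + \<omega> * \<omega>) - 3 * \<omega>" by (simp add: algebra_simps)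
  also have "\<dots> = 0" using omega_sum \<open>3 = 0\<close> by simp
  finally show False using neq_1 by simp
qed

lemma e_cong: "k mod 3 = l mod 3 \<Longrightarrow> e k = e l"
  by (simp add: e_def)

lemma omega_square_neq_1: "\<omega> * \<omega> \<noteq> 1"
  using cube neq_1 by (auto simp: power3_eq_cube)

lemma e_0: "e 0 = 1" and e_1: "e 1 = \<omega>" and e_2: "e 2 = \<omega> * \<omega>"
  by (simp_all add: e_def power2_eq_square)

lemma e_add: "e (k + l) = e k * e l"
proof -
  have 3: "\<omega> * (\<omega> * \<omega>) = 1" using cube by (simp add: power3_eq_cube mult.assoc)
  have "(k + l) mod 3 = (k mod 3 + l mod 3) mod 3" by presburger
  then show ?thesis
    using 3 by (cases k rule: mod_3_cases; cases l rule: mod_3_cases)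
      (simp_all add: e_def power2_eq_square numeral_eq_Suc mult_ac)
qed

lemma e_eq_1_iff: "e k = 1 \<longleftrightarrow> k mod 3 = 0"
  using neq_1 omega_square_neq_1
  by (cases k rule: mod_3_cases) (simp_all add: e_def power2_eq_square)

lemma e_mult_nat: "e (int m * k) = e k ^ m"
  by (induction m) (simp_all add: e_0 e_add distrib_right)

lemma cube_root_of_unity_cases:
  assumes "x ^ 3 = 1"
  obtains k where "x = e k"
proof -
  have "(x - 1) * ((x - \<omega>) * (x - \<omega> * \<omega>)) =
      x ^ 3 - (1 + \<omega> + \<omega> * \<omega>) * x * x + \<omega> * (1 + \<omega> + \<omega> * \<omega>) * x - \<omega> ^ 3"
    by (simp add: algebra_simps power3_eq_cube)
  then have "(x - 1) * ((x - \<omega>) * (x - \<omega> * \<omega>)) = 0"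
    using omega_sum assms cube by simp
  then show ?thesis
    using that[of 0] that[of 1] that[of 2] by (auto simp: e_0 e_1 e_2)
qed

section \<open>Spectral decomposition of a matrix of order three\<close>

text \<open>If \<open>M\<close> has cube one, this is three times the projection of \<open>u\<close>
  to the eigenspace of \<open>M\<close> for \<open>e r\<close>. Keeping the factor three avoids
  division.\<close>

definition eigen_part :: "'k mat \<Rightarrow> int \<Rightarrow> 'k vec \<Rightarrow> 'k vec" where
  "eigen_part M r u = u + e (- r) \<cdot>\<^sub>v (M *\<^sub>v u) + e (- (2 * r)) \<cdot>\<^sub>v (M *\<^sub>v (M *\<^sub>v u))"

context
  fixes M :: "'k mat" and n :: nat and u :: "'k vec"
  assumes M: "M \<in> carrier_mat n n" and u: "u \<in> carrier_vec n"
begin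

lemma eigen_part_carrier: "eigen_part M r u \<in> carrier_vec n"
  using M u by (simp add: eigen_part_def)

lemma mult_eigen_part:
  assumes "N \<in> carrier_mat n n"
  shows "N *\<^sub>v eigen_part M r u =
    N *\<^sub>v u + e (- r) \<cdot>\<^sub>v (N *\<^sub>v (M *\<^sub>v u)) + e (- (2 * r)) \<cdot>\<^sub>v (N *\<^sub>v (M *\<^sub>v (M *\<^sub>v u)))"
  using M u assms
  by (simp add: eigen_part_def mult_add_distrib_mat_vec[of N n n] mult_mat_vec[of N n n]
      del: assoc_add_vec)

text \<open>Since the cube of \<open>M\<close> fixes \<open>u\<close>, applying \<open>M\<close>
  permutes the three terms cyclically up to the factor \<open>e r\<close>.\<close>

lemma eigen_part_eigen:
  assumes "M * (M * M) = 1\<^sub>m n"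
  shows "M *\<^sub>v eigen_part M r u = e r \<cdot>\<^sub>v eigen_part M r u"
proof -
  have "M *\<^sub>v (M *\<^sub>v (M *\<^sub>v u)) = (M * (M * M)) *\<^sub>v u"
    using M u by (simp add: assoc_mult_mat_vec[of _ n n _ n])
  then have MMM: "M *\<^sub>v (M *\<^sub>v (M *\<^sub>v u)) = u" using assms u by simp
  have e: "e r * e (- r) = 1" "e r * e (- (2 * r)) = e (- r)" "e r = e (- (2 * r))"
    by (simp_all add: e_0 flip: e_add) (rule e_cong, presburger)
  have Mu: "M *\<^sub>v u \<in> carrier_vec n" "M *\<^sub>v (M *\<^sub>v u) \<in> carrier_vec n"
    using M u by auto
  have key: "a1 + (e (- r) * a2 + e (- (2 * r)) * a0) = e r * (a0 + (e (- r) * a1 + e (- (2 * r)) * a2))"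
    for a0 a1 a2
  proof -
    have "e r * (a0 + (e (- r) * a1 + e (- (2 * r)) * a2)) =
        e r * a0 + ((e r * e (- r)) * a1 + (e r * e (- (2 * r))) * a2)"
      by (simp only: distrib_left mult.assoc)
    then show ?thesis unfolding e(1,2) using e(3) by simp
  qed
  show ?thesis
    unfolding mult_eigen_part[OF M] MMM unfolding eigen_part_def
    using Mu u M by (intro eq_vecI) (auto simp: key[symmetric] add.assoc)
qed

text \<open>Whatever commutes with \<open>M\<close> commutes with its projections. Projecting under
  two commuting matrices in turn thus yields simultaneous eigenvectors.\<close>

lemma eigen_part_commute:
  assumes "N \<in> carrier_mat n n" "N * M = M * N" "N *\<^sub>v u = c \<cdot>\<^sub>v u"
  shows "N *\<^sub>v eigen_part M r u = c \<cdot>\<^sub>v eigen_part M r u"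
proof -
  have NM: "N *\<^sub>v (M *\<^sub>v x) = M *\<^sub>v (N *\<^sub>v x)" if "x \<in> carrier_vec n" for x
    using that M assms(1,2) by (metis assoc_mult_mat_vec)
  have Mu: "M *\<^sub>v u \<in> carrier_vec n" "M *\<^sub>v (M *\<^sub>v u) \<in> carrier_vec n"
    using M u by auto
  have "N *\<^sub>v (M *\<^sub>v u) = c \<cdot>\<^sub>v (M *\<^sub>v u)" "N *\<^sub>v (M *\<^sub>v (M *\<^sub>v u)) = c \<cdot>\<^sub>v (M *\<^sub>v (M *\<^sub>v u))"
    using M u Mu assms(3) by (simp_all add: NM mult_mat_vec[of M n n])
  then show ?thesis
    unfolding mult_eigen_part[OF assms(1)] assms(3) unfolding eigen_part_def
    using Mu u M by (intro eq_vecI) (auto simp: distrib_left mult.left_commute)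
qed

text \<open>In the sum of the three parts the coefficients of \<open>M u\<close> and
  \<open>M (M u)\<close> are both the sum of all cube roots of unity, which is zero.\<close>

lemma scalar_prod_eigen_part:
  assumes x: "x \<in> carrier_vec n"
  shows "3 * (u \<bullet> x) = eigen_part M 0 u \<bullet> x + eigen_part M 1 u \<bullet> x + eigen_part M 2 u \<bullet> x"
proof -
  have Mu: "M *\<^sub>v u \<in> carrier_vec n" "M *\<^sub>v (M *\<^sub>v u) \<in> carrier_vec n"
    using M u by auto
  have *: "eigen_part M r u \<bullet> x =
      u \<bullet> x + e (- r) * ((M *\<^sub>v u) \<bullet> x) + e (- (2 * r)) * ((M *\<^sub>v (M *\<^sub>v u)) \<bullet> x)" for r
    using Mu u x by (simp add: eigen_part_def add_scalar_prod_distrib[of _ n])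
  have "e (- 1) = \<omega> * \<omega>" "e (- 2) = \<omega>" "e (- 4) = \<omega> * \<omega>"
    by (simp_all add: e_def power2_eq_square)
  then have "eigen_part M 0 u \<bullet> x + eigen_part M 1 u \<bullet> x + eigen_part M 2 u \<bullet> x =
      3 * (u \<bullet> x) + (1 + \<omega> + \<omega> * \<omega>) * ((M *\<^sub>v u) \<bullet> x) + (1 + \<omega> + \<omega> * \<omega>) * ((M *\<^sub>v (M *\<^sub>v u)) \<bullet> x)"
    unfolding * by (simp add: e_0 algebra_simps)
  then show ?thesis by (simp add: omega_sum)
qed

end

end

section \<open>Characters of the plane over the field with three elements\<close>

text \<open>Transfers divisibility by three along an explicit identity, so that the case checks
  below reduce to ring arithmetic.\<close>

lemma mod_3_combination: "x mod 3 = 0 \<Longrightarrow> y = a * x + 3 * c \<Longrightarrow> y mod 3 = 0" for x y a c :: int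
  by auto

text \<open>If the weights span a plane, then every weight is a combination of
  two fixed ones with coefficients \<open>0\<close> or \<open>\<plusminus>1\<close>, and so takes part in a zero-sum relation of
  length at most four with them.\<close>

lemma linear_functional_exists:
  fixes S :: "(int \<times> int \<times> int) set"
  assumes rel1: "\<And>p q k. (p, q, k) \<in> S \<Longrightarrow> p mod 3 = 0 \<Longrightarrow> q mod 3 = 0 \<Longrightarrow> k mod 3 = 0"
    and rel2: "\<And>p q k p' q' k'. (p, q, k) \<in> S \<Longrightarrow> (p', q', k') \<in> S \<Longrightarrow>
      (p + p') mod 3 = 0 \<Longrightarrow> (q + q') mod 3 = 0 \<Longrightarrow> (k + k') mod 3 = 0"
    and rel3: "\<And>p q k p' q' k' p'' q'' k''. (p, q, k) \<in> S \<Longrightarrow> (p', q', k') \<in> S \<Longrightarrow> (p'', q'', k'') \<in> S \<Longrightarrow>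
      (p + p' + p'') mod 3 = 0 \<Longrightarrow> (q + q' + q'') mod 3 = 0 \<Longrightarrow> (k + k' + k'') mod 3 = 0"
    and rel4: "\<And>p q k p' q' k' p'' q'' k''. (p, q, k) \<in> S \<Longrightarrow> (p', q', k') \<in> S \<Longrightarrow> (p'', q'', k'') \<in> S \<Longrightarrow>
      (p + p' + 2 * p'') mod 3 = 0 \<Longrightarrow> (q + q' + 2 * q'') mod 3 = 0 \<Longrightarrow> (k + k' + 2 * k'') mod 3 = 0"
  obtains i j where "\<And>p q k. (p, q, k) \<in> S \<Longrightarrow> (k - (p * i + q * j)) mod 3 = 0"
proof -
  \<comment> \<open>Modulo three the weights span a plane, a line or only the origin.\<close>
  consider (indep) p1 q1 k1 p2 q2 k2 where "(p1, q1, k1) \<in> S" "(p2, q2, k2) \<in> S"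
      "(p1 * q2 - p2 * q1) mod 3 \<noteq> 0"
    | (dep) p1 q1 k1 where "(p1, q1, k1) \<in> S" "p1 mod 3 \<noteq> 0 \<or> q1 mod 3 \<noteq> 0"
      "\<And>p q k. (p, q, k) \<in> S \<Longrightarrow> (p1 * q - p * q1) mod 3 = 0"
    | (zero) "\<And>p q k. (p, q, k) \<in> S \<Longrightarrow> p mod 3 = 0 \<and> q mod 3 = 0"
    by metis
  then show ?thesis
  proof cases
    case indep
    define d where "d = p1 * q2 - p2 * q1"
    \<comment> \<open>A nonzero residue modulo three is its own inverse. Multiplying by
      \<open>d\<close> therefore divides by the determinant, and \<open>i\<close>, \<open>j\<close>,
      \<open>s\<close>, \<open>t\<close> below come from Cramer's rule.\<close>
    have dd: "(d * d) mod 3 = 1"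
      using indep(3) unfolding d_def[symmetric]
      by (cases d rule: mod_3_cases) (simp_all add: mod_mult_eq[symmetric, of d d])
    define i where "i = d * (k1 * q2 - k2 * q1)"
    define j where "j = d * (p1 * k2 - p2 * k1)"
    show ?thesis
    proof (rule that[of i j])
      fix p q k assume S: "(p, q, k) \<in> S"
      define s where "s = d * (p * q2 - p2 * q)"
      define t where "t = d * (p1 * q - p * q1)"
      have eq: "s * p1 + t * p2 = (d * d) * p" "s * q1 + t * q2 = (d * d) * q"
        "p * i + q * j = s * k1 + t * k2"
        unfolding s_def t_def i_def j_def d_def by (simp_all add: algebra_simps)
      have sp: "(p - (s * p1 + t * p2)) mod 3 = 0" "(q - (s * q1 + t * q2)) mod 3 = 0"
        unfolding eq using dd
        by (metis cancel_comm_monoid_add_class.diff_cancel mod_0 mod_diff_right_eq mod_mult_left_eq mult_1)+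
      obtain s' t' where st: "s = s' + 3 * (s div 3)" "t = t' + 3 * (t div 3)"
          "s' \<in> {0, 1, 2}" "t' \<in> {0, 1, 2}"
        by (rule that[of "s mod 3" "t mod 3"]) (use mod_in(1) in \<open>simp_all only: mod_mult_div_eq\<close>)
      have st1: "s' = s - 3 * (s div 3)" "t' = t - 3 * (t div 3)"
        using st(1,2) by linarith+
      have red: "(x - (s * y + t * z)) mod 3 = (x - (s' * y + t' * z)) mod 3" for x y z
      proof -
        have "x - (s' * y + t' * z) = x - (s * y + t * z) + 3 * ((s div 3) * y + (t div 3) * z)"
          by (simp only: st1 algebra_simps)
        then show ?thesis by (simp only: mod_mult_self2)
      qed
      note sp = sp[unfolded red]
      have "(s', t') \<in> {(0,0),(0,1),(0,2),(1,0),(1,1),(1,2),(2,0),(2,1),(2,2)}"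
        using st(3,4) by auto
      \<comment> \<open>Moved to the other side, a coefficient 1 becomes 2 and a coefficient 2
        becomes 1, which gives a zero-sum relation. For \<open>s' = t' = 1\<close> the relation is
        doubled, shortening p + 2 p1 + 2 p2 to 2 p + p1 + p2.\<close>
      then show "(k - (p * i + q * j)) mod 3 = 0"
        unfolding eq red
      proof (elim insertE emptyE Pair_inject, goal_cases)
        case 1
        then show ?case using rel1[OF S] sp by simp
      next
        case 2
        show ?case
          by (rule mod_3_combination[OF rel3[OF indep(2) indep(2) S
              mod_3_combination[OF sp(1), of _ 1 "p2"] mod_3_combination[OF sp(2), of _ 1 "q2"]],
              of _ 1 "- k2"])
            (simp_all add: 2 algebra_simps)
      next
        case 3
        show ?case
          by (rule mod_3_combination[OF rel2[OF indep(2) S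
              mod_3_combination[OF sp(1), of _ 1 "p2"] mod_3_combination[OF sp(2), of _ 1 "q2"]],
              of _ 1 "- k2"])
            (simp_all add: 3 algebra_simps)
      next
        case 4
        show ?case
          by (rule mod_3_combination[OF rel3[OF indep(1) indep(1) S
              mod_3_combination[OF sp(1), of _ 1 "p1"] mod_3_combination[OF sp(2), of _ 1 "q1"]],
              of _ 1 "- k1"])
            (simp_all add: 4 algebra_simps)
      next
        case 5
        show ?case
          by (rule mod_3_combination[OF rel4[OF indep(1) indep(2) S
              mod_3_combination[OF sp(1), of _ 2 "p1 + p2"] mod_3_combination[OF sp(2), of _ 2 "q1 + q2"]],
              of _ 2 "- (k1 + k2 + k)"])
            (simp_all add: 5 algebra_simps)
      next
        case 6
        show ?case
          by (rule mod_3_combination[OF rel4[OF S indep(2) indep(1)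
              mod_3_combination[OF sp(1), of _ 1 "p1 + p2"] mod_3_combination[OF sp(2), of _ 1 "q1 + q2"]],
              of _ 1 "- (k1 + k2)"])
            (simp_all add: 6 algebra_simps)
      next
        case 7
        show ?case
          by (rule mod_3_combination[OF rel2[OF indep(1) S
              mod_3_combination[OF sp(1), of _ 1 "p1"] mod_3_combination[OF sp(2), of _ 1 "q1"]],
              of _ 1 "- k1"])
            (simp_all add: 7 algebra_simps)
      next
        case 8
        show ?case
          by (rule mod_3_combination[OF rel4[OF S indep(1) indep(2)
              mod_3_combination[OF sp(1), of _ 1 "p1 + p2"] mod_3_combination[OF sp(2), of _ 1 "q1 + q2"]],
              of _ 1 "- (k1 + k2)"])
            (simp_all add: 8 algebra_simps)
      next
        case 9
        show ?case
          by (rule mod_3_combination[OF rel3[OF indep(1) indep(2) S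
              mod_3_combination[OF sp(1), of _ 1 "p1 + p2"] mod_3_combination[OF sp(2), of _ 1 "q1 + q2"]],
              of _ 1 "- (k1 + k2)"])
            (simp_all add: 9 algebra_simps)
      qed
    qed
  next
    case dep
    have sq: "(p1 mod 3 \<noteq> 0 \<longrightarrow> (p1 * p1) mod 3 = 1) \<and> (q1 mod 3 \<noteq> 0 \<longrightarrow> (q1 * q1) mod 3 = 1)"
      by (cases p1 rule: mod_3_cases; cases q1 rule: mod_3_cases)
        (simp_all add: mod_mult_eq[symmetric, of p1 p1] mod_mult_eq[symmetric, of q1 q1])
    \<comment> \<open>On a line the functional is fixed by its value \<open>k1\<close> at
      \<open>(p1, q1)\<close>. A coordinate that is nonzero modulo three serves as its own
      inverse.\<close>
    define i where "i = (if p1 mod 3 \<noteq> 0 then p1 * k1 else 0)"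
    define j where "j = (if p1 mod 3 \<noteq> 0 then 0 else q1 * k1)"
    show ?thesis
    proof (rule that[of i j])
      fix p q k assume S: "(p, q, k) \<in> S"
      define s where "s = (if p1 mod 3 \<noteq> 0 then p1 * p else q1 * q)"
      note d = dep(3)[OF S]
      have eq: "p * i + q * j = s * k1"
        by (simp add: s_def i_def j_def)
      \<comment> \<open>As the determinant vanishes modulo three, \<open>(p, q)\<close> is congruent
        to \<open>s\<close> times \<open>(p1, q1)\<close>.\<close>
      have sp: "(p - s * p1) mod 3 = 0 \<and> (q - s * q1) mod 3 = 0"
      proof (cases "p1 mod 3 = 0")
        case False
        have 1: "p - s * p1 = p * (1 - p1 * p1)" "q - s * q1 = q * (1 - p1 * p1) + p1 * (p1 * q - p * q1)"
          using False by (simp_all add: s_def algebra_simps)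
        have "3 dvd 1 - p1 * p1" using sq False by presburger
        then show ?thesis unfolding 1 using d by (auto simp flip: dvd_eq_mod_eq_0)
      next
        case True
        have 1: "p - s * p1 = p * (1 - q1 * q1) - q1 * (p1 * q - p * q1)" "q - s * q1 = q * (1 - q1 * q1)"
          using True by (simp_all add: s_def algebra_simps)
        have "3 dvd 1 - q1 * q1" using sq True dep(2) by presburger
        then show ?thesis unfolding 1 using d by (auto simp flip: dvd_eq_mod_eq_0)
      qed
      obtain s' where st: "s = s' + 3 * (s div 3)" "s' \<in> {0, 1, 2}"
        by (rule that[of "s mod 3"]) (use mod_in(1) in \<open>simp_all only: mod_mult_div_eq\<close>)
      have st1: "s' = s - 3 * (s div 3)"
        using st(1) by linarith
      have red: "(x - s * y) mod 3 = (x - s' * y) mod 3" for x y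
      proof -
        have "x - s' * y = x - s * y + 3 * ((s div 3) * y)"
          by (simp only: st1 algebra_simps)
        then show ?thesis by (simp only: mod_mult_self2)
      qed
      note sp = sp[unfolded red]
      show "(k - (p * i + q * j)) mod 3 = 0"
        unfolding eq red using st(2)
      proof (elim insertE emptyE, goal_cases)
        case 1
        then show ?case using rel1[OF S] sp by simp
      next
        case 2
        show ?case
          by (rule mod_3_combination[OF rel3[OF dep(1) dep(1) S
              mod_3_combination[OF conjunct1[OF sp], of _ 1 "p1"] mod_3_combination[OF conjunct2[OF sp], of _ 1 "q1"]],
              of _ 1 "- k1"])
            (simp_all add: 2 algebra_simps)
      next
        case 3
        show ?case
          by (rule mod_3_combination[OF rel2[OF dep(1) S
              mod_3_combination[OF conjunct1[OF sp], of _ 1 "p1"] mod_3_combination[OF conjunct2[OF sp], of _ 1 "q1"]],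
              of _ 1 "- k1"])
            (simp_all add: 3 algebra_simps)
      qed
    qed
  next
    case zero
    have "(k - (p * 0 + q * 0)) mod 3 = 0" if "(p, q, k) \<in> S" for p q k
      using rel1[OF that] zero[OF that] by simp
    then show ?thesis by (rule that)
  qed
qed

section \<open>Semi-invariants\<close>

text \<open>The defining relations of the group, imposed on matrices. Inverses of \<open>A\<close>
  and \<open>B\<close> are written as squares, so \<open>CA\<close> and \<open>CB\<close> say that
  conjugation by \<open>C\<close> inverts them.\<close>

locale generator_matrices = cube_root \<omega> for \<omega> :: "'k::field" +
  fixes n :: nat and A B C :: "'k mat"
  assumes A: "A \<in> carrier_mat n n" and B: "B \<in> carrier_mat n n" and C: "C \<in> carrier_mat n n"
    and AAA: "A * (A * A) = 1\<^sub>m n" and BBB: "B * (B * B) = 1\<^sub>m n" and CC: "C * C = 1\<^sub>m n"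
    and AB: "A * B = B * A" and CA: "C * A = A * (A * C)" and CB: "C * B = B * (B * C)"
begin

lemma CCx: "x \<in> carrier_vec n \<Longrightarrow> C *\<^sub>v (C *\<^sub>v x) = x"
  using C CC by (simp flip: assoc_mult_mat_vec[of C n n C n])

lemma Cx: "x \<in> carrier_vec n \<Longrightarrow> C *\<^sub>v x \<in> carrier_vec n"
  using C by simp

text \<open>Weight \<open>(0, 0)\<close> gives the invariants of the normal subgroup. Weights matter
  only modulo three, and \<open>d\<close> is merely an upper bound for the degree.\<close>

definition semi_invariants :: "int \<Rightarrow> int \<Rightarrow> nat \<Rightarrow> 'k mpoly set" where
  "semi_invariants p q d = {f \<in> polys_upto n d.
     compose_linear A f = Const (e p) * f \<and> compose_linear B f = Const (e q) * f}"

lemma semi_invariants_coord_ring: "f \<in> semi_invariants p q d \<Longrightarrow> f \<in> coord_ring n"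
  by (simp add: semi_invariants_def polys_upto_def)

lemma semi_invariants_cong:
  assumes "f \<in> semi_invariants p q d" "(p - p') mod 3 = 0" "(q - q') mod 3 = 0" "d \<le> d'"
  shows "f \<in> semi_invariants p' q' d'"
proof -
  have "p mod 3 = p' mod 3" "q mod 3 = q' mod 3" using assms(2,3) by presburger+
  then have "e p = e p'" "e q = e q'" by (auto intro: e_cong)
  then show ?thesis
    using assms(1,4) polys_upto_mono by (auto simp: semi_invariants_def)
qed

lemma semi_invariants_mult:
  assumes "f \<in> semi_invariants p q d" "g \<in> semi_invariants p' q' d'"
  shows "f * g \<in> semi_invariants (p + p') (q + q') (d + d')"
  using assms
  by (simp add: semi_invariants_def polys_upto_mult compose_linear.hom_mult e_add Const.hom_mult mult_ac)

text \<open>Moving \<open>A\<close> past \<open>C\<close> produces \<open>A\<close> twice, and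
  \<open>e r * e r = e (- r)\<close>; hence \<open>C\<close> negates weights.\<close>

lemma semi_invariants_conj:
  assumes f: "f \<in> semi_invariants p q d"
  shows "compose_linear C f \<in> semi_invariants (- p) (- q) d"
proof -
  note coord = semi_invariants_coord_ring[OF f]
  have *: "compose_linear M (compose_linear C f) = Const (e (- r)) * compose_linear C f"
    if "C * M = M * (M * C)" "compose_linear M f = Const (e r) * f" "M \<in> carrier_mat n n" for M r
  proof -
    have "compose_linear M (compose_linear C f) = compose_linear (M * (M * C)) f"
      using compose_linear_compose_linear[OF C that(3) coord] that(1) by simp
    also have "\<dots> = compose_linear (M * C) (compose_linear M f)"
      using that(3) C coord by (intro compose_linear_compose_linear[symmetric]) auto
    also have "\<dots> = Const (e r) * compose_linear C (compose_linear M f)"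
      using compose_linear_compose_linear[OF that(3) C coord] that(2)
      by (simp add: compose_linear.hom_mult)
    also have "\<dots> = Const (e r * e r) * compose_linear C f"
      by (simp add: that(2) compose_linear.hom_mult Const.hom_mult mult.assoc)
    also have "e r * e r = e (- r)"
      by (simp flip: e_add) (rule e_cong, presburger)
    finally show ?thesis .
  qed
  show ?thesis
    using *[OF CA _ A] *[OF CB _ B] f compose_linear_in_polys_upto[OF C]
    by (simp add: semi_invariants_def)
qed

lemma eval_at_conj:
  "f \<in> semi_invariants p q d \<Longrightarrow> x \<in> carrier_vec n \<Longrightarrow>
    eval_at x (compose_linear C f) = eval_at (C *\<^sub>v x) f"
  by (intro eval_at_compose_linear[OF C] semi_invariants_coord_ring)

section \<open>Simultaneous eigenspaces of linear forms\<close>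

definition weight_space :: "int \<Rightarrow> int \<Rightarrow> 'k vec set" where
  "weight_space p q = {u \<in> carrier_vec n.
     transpose_mat A *\<^sub>v u = e p \<cdot>\<^sub>v u \<and> transpose_mat B *\<^sub>v u = e q \<cdot>\<^sub>v u}"

lemma linear_form_semi_invariant:
  "u \<in> weight_space p q \<Longrightarrow> linear_form n u \<in> semi_invariants p q 1"
  using A B
  by (simp add: weight_space_def semi_invariants_def linear_form_in_polys_upto[simplified]
      compose_linear_linear_form linear_form_smult)

text \<open>Simultaneous eigenforms span all linear forms: a form is split under \<open>A\<close>,
  then each part under \<open>B\<close>. As 3 is invertible, agreement passes from the parts to the
  form, in particular to coordinates.\<close>

lemma eq_if_weight_spaces:
  assumes x: "x \<in> carrier_vec n" and y: "y \<in> carrier_vec n"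
    and eq: "\<And>p q u. u \<in> weight_space p q \<Longrightarrow> u \<bullet> x = u \<bullet> y"
  shows "x = y"
proof -
  let ?A = "transpose_mat A" and ?B = "transpose_mat B"
  have A': "?A \<in> carrier_mat n n" and B': "?B \<in> carrier_mat n n" using A B by auto
  have AAA': "?A * (?A * ?A) = 1\<^sub>m n" and BBB': "?B * (?B * ?B) = 1\<^sub>m n" and AB': "?A * ?B = ?B * ?A"
    using A B AAA BBB AB
    by (metis assoc_mult_mat mult_carrier_mat transpose_mult transpose_one)+
  have *: "u \<bullet> x = u \<bullet> y"
    if u: "u \<in> carrier_vec n" and M: "M \<in> carrier_mat n n"
      and parts: "\<And>r. eigen_part M r u \<bullet> x = eigen_part M r u \<bullet> y" for M u
    using scalar_prod_eigen_part[OF M u x] scalar_prod_eigen_part[OF M u y] parts three_neq_0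
    by (metis mult_left_cancel)
  have "u \<bullet> x = u \<bullet> y" if u: "u \<in> carrier_vec n" for u
  proof (rule *[OF u A'])
    fix r
    let ?u = "eigen_part ?A r u"
    have u': "?u \<in> carrier_vec n" by (rule eigen_part_carrier[OF A' u])
    show "?u \<bullet> x = ?u \<bullet> y"
    proof (rule *[OF u' B'])
      fix s
      show "eigen_part ?B s ?u \<bullet> x = eigen_part ?B s ?u \<bullet> y"
        by (rule eq[of _ r s])
          (simp add: weight_space_def eigen_part_carrier[OF B' u'] eigen_part_eigen[OF B' u' BBB']
            eigen_part_commute[OF B' u' A' AB' eigen_part_eigen[OF A' u AAA']])
    qed
  qed
  then have "unit_vec n i \<bullet> x = unit_vec n i \<bullet> y" for i by simp
  then show ?thesis
    using x y by (intro eq_vecI) (metis carrier_vecD scalar_prod_left_unit, auto)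
qed

lemma scalar_prod_pow:
  assumes "M \<in> carrier_mat n n" "u \<in> carrier_vec n" "transpose_mat M *\<^sub>v u = e p \<cdot>\<^sub>v u" "x \<in> carrier_vec n"
  shows "u \<bullet> (M ^\<^sub>m m *\<^sub>v x) = e (int m * p) * (u \<bullet> x)"
  using assms(4)
proof (induction m arbitrary: x)
  case 0
  then show ?case using assms by (simp add: e_0)
next
  case (Suc m)
  have "u \<bullet> (M ^\<^sub>m Suc m *\<^sub>v x) = u \<bullet> (M ^\<^sub>m m *\<^sub>v (M *\<^sub>v x))"
    using assms(1) Suc.prems by (simp add: assoc_mult_mat_vec[of _ n n _ n])
  also have "\<dots> = e (int m * p) * (u \<bullet> (M *\<^sub>v x))"
    using assms(1) Suc by auto
  also have "u \<bullet> (M *\<^sub>v x) = (transpose_mat M *\<^sub>v u) \<bullet> x"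
    using transpose_vec_mult_scalar[OF assms(1) Suc.prems assms(2)] by simp
  also have "\<dots> = e p * (u \<bullet> x)"
    using assms Suc.prems by simp
  finally show ?case by (simp add: distrib_right e_add)
qed

section \<open>Separation by invariants of degree at most six\<close>

text \<open>Relations of length four lie beyond the reach of \<open>deg3\<close>. The gap is bridged
  because the conjugate of \<open>z\<close> under \<open>C\<close> has the weight of
  \<open>z * z\<close> and can stand in for it in degree three.\<close>

lemma agree_in_degree_4:
  assumes v: "v \<in> carrier_vec n" and w: "w \<in> carrier_vec n"
    and sym: "\<And>f. f \<in> semi_invariants 0 0 6 \<Longrightarrow>
      eval_at v f + eval_at (C *\<^sub>v v) f = eval_at w f + eval_at (C *\<^sub>v w) f"
    and deg3: "\<And>f. f \<in> semi_invariants 0 0 3 \<Longrightarrow> eval_at v f = eval_at w f"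
    and x: "x \<in> semi_invariants p1 q1 1" and y: "y \<in> semi_invariants p2 q2 1"
    and z: "z \<in> semi_invariants p3 q3 1"
    and p: "(p1 + p2 + 2 * p3) mod 3 = 0" and q: "(q1 + q2 + 2 * q3) mod 3 = 0"
  shows "eval_at v (x * y * (z * z)) = eval_at w (x * y * (z * z))"
proof -
  let ?z = "compose_linear C z"
  note z' = semi_invariants_conj[OF z]
  have m4: "x * y * (z * z) \<in> semi_invariants 0 0 6"
    by (rule semi_invariants_cong[OF semi_invariants_mult[OF semi_invariants_mult[OF x y]
          semi_invariants_mult[OF z z]]]) (use p q in presburger)+
  have zzz: "z * z * z \<in> semi_invariants 0 0 3"
    by (rule semi_invariants_cong[OF semi_invariants_mult[OF semi_invariants_mult[OF z z] z]]) presburger+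
  have zzz': "?z * ?z * ?z \<in> semi_invariants 0 0 3"
    by (rule semi_invariants_cong[OF semi_invariants_mult[OF semi_invariants_mult[OF z' z'] z']]) presburger+
  have zz': "z * ?z \<in> semi_invariants 0 0 3"
    by (rule semi_invariants_cong[OF semi_invariants_mult[OF z z']]) presburger+
  have xyz': "x * y * ?z \<in> semi_invariants 0 0 3"
    by (rule semi_invariants_cong[OF semi_invariants_mult[OF semi_invariants_mult[OF x y] z']])
      (use p q in presburger)+
  note eval = eval_at.hom_mult eval_at_conj[OF z v] eval_at_conj[OF z w]
  note zzz = deg3[OF zzz, unfolded eval] and zzz' = deg3[OF zzz', unfolded eval]
    and zz' = deg3[OF zz', unfolded eval] and xyz' = deg3[OF xyz', unfolded eval]
    and m4 = sym[OF m4, unfolded eval_at.hom_mult]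
  \<comment> \<open>The cubes of \<open>z\<close> and of its conjugate are invariants of degree
    three, so each factor vanishes at \<open>v\<close> exactly when it vanishes at \<open>w\<close>.
    In the second case the conjugate of the monomial vanishes at both points and \<open>sym\<close>
    leaves the monomial.\<close>
  consider "eval_at v z = 0" | "eval_at (C *\<^sub>v v) z = 0"
    | "eval_at v z \<noteq> 0" "eval_at (C *\<^sub>v v) z \<noteq> 0" by blast
  then show ?thesis
  proof cases
    case 1
    then show ?thesis using zzz by (simp add: eval_at.hom_mult)
  next
    case 2
    then show ?thesis using zzz' m4 by (simp add: eval_at.hom_mult)
  next
    case 3
    have "eval_at x' (x * y * (z * z)) * (eval_at x' z * eval_at (C *\<^sub>v x') z) =
        (eval_at x' x * eval_at x' y * eval_at (C *\<^sub>v x') z) * (eval_at x' z * eval_at x' z * eval_at x' z)"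
      for x' by (simp add: eval_at.hom_mult mult_ac)
    then have "eval_at v (x * y * (z * z)) * (eval_at v z * eval_at (C *\<^sub>v v) z) =
        eval_at w (x * y * (z * z)) * (eval_at v z * eval_at (C *\<^sub>v v) z)"
      using zzz zz' xyz' by metis
    then show ?thesis using 3 by simp
  qed
qed

text \<open>Each linear eigenform changes from \<open>v\<close> to \<open>w\<close> by a cube root
  of unity. Zero-sum relations make its exponent linear in the weight, and such a family of factors
  is the effect of a single element of the normal subgroup.\<close>

lemma translate_if_agree_in_degree_3:
  assumes v: "v \<in> carrier_vec n" and w: "w \<in> carrier_vec n"
    and sym: "\<And>f. f \<in> semi_invariants 0 0 6 \<Longrightarrow>
      eval_at v f + eval_at (C *\<^sub>v v) f = eval_at w f + eval_at (C *\<^sub>v w) f"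
    and deg3: "\<And>f. f \<in> semi_invariants 0 0 3 \<Longrightarrow> eval_at v f = eval_at w f"
  obtains i j where "w = A ^\<^sub>m i *\<^sub>v (B ^\<^sub>m j *\<^sub>v v)"
proof -
  \<comment> \<open>A relation, not a function: a priori two forms of equal weight may have
    different ratios \<open>e k\<close>, and \<open>k\<close> is determined only modulo
    three.\<close>
  define S where "S = {(p, q, k). \<exists>u\<in>weight_space p q. u \<bullet> v \<noteq> 0 \<and> u \<bullet> w = e k * (u \<bullet> v)}"
  have S: "\<exists>f. f \<in> semi_invariants p q 1 \<and> eval_at v f \<noteq> 0 \<and> eval_at w f = e k * eval_at v f"
    if mem: "(p, q, k) \<in> S" for p q k
  proof -
    obtain u where u: "u \<in> weight_space p q" "u \<bullet> v \<noteq> 0" "u \<bullet> w = e k * (u \<bullet> v)"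
      using mem unfolding S_def by blast
    show ?thesis
      using linear_form_semi_invariant[OF u(1)] u(2,3) v w
      by (intro exI[of _ "linear_form n u"]) (simp add: eval_at_linear_form)
  qed
  have e_trivial: "k mod 3 = 0" if "e k * y = y" "y \<noteq> 0" for k y
    using that by (simp add: e_eq_1_iff)
  obtain i j where ij: "\<And>p q k. (p, q, k) \<in> S \<Longrightarrow> (k - (p * i + q * j)) mod 3 = 0"
  proof (rule linear_functional_exists[of S])
    fix p q k assume "(p, q, k) \<in> S" and pq: "p mod 3 = 0" "q mod 3 = 0"
    then obtain f where f: "f \<in> semi_invariants p q 1" "eval_at v f \<noteq> 0" "eval_at w f = e k * eval_at v f"
      using S by blast
    have "eval_at w f = eval_at v f"
      by (rule deg3[symmetric], rule semi_invariants_cong[OF f(1)]) (use pq in simp_all)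
    with f show "k mod 3 = 0" by (intro e_trivial[of k "eval_at v f"]) simp_all
  next
    fix p q k p' q' k' assume "(p, q, k) \<in> S" "(p', q', k') \<in> S"
      and pq: "(p + p') mod 3 = 0" "(q + q') mod 3 = 0"
    then obtain f g where f: "f \<in> semi_invariants p q 1" "eval_at v f \<noteq> 0" "eval_at w f = e k * eval_at v f"
      and g: "g \<in> semi_invariants p' q' 1" "eval_at v g \<noteq> 0" "eval_at w g = e k' * eval_at v g"
      using S by meson
    have "eval_at w (f * g) = eval_at v (f * g)"
      by (rule deg3[symmetric], rule semi_invariants_cong[OF semi_invariants_mult[OF f(1) g(1)]]) (use pq in simp_all)
    with f g show "(k + k') mod 3 = 0"
      by (intro e_trivial[of _ "eval_at v (f * g)"]) (simp_all add: eval_at.hom_mult e_add mult_ac)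
  next
    fix p q k p' q' k' p'' q'' k''
    assume "(p, q, k) \<in> S" "(p', q', k') \<in> S" "(p'', q'', k'') \<in> S"
    then obtain f g h where f: "f \<in> semi_invariants p q 1" "eval_at v f \<noteq> 0" "eval_at w f = e k * eval_at v f"
      and g: "g \<in> semi_invariants p' q' 1" "eval_at v g \<noteq> 0" "eval_at w g = e k' * eval_at v g"
      and h: "h \<in> semi_invariants p'' q'' 1" "eval_at v h \<noteq> 0" "eval_at w h = e k'' * eval_at v h"
      using S by meson
    {
      assume pq: "(p + p' + p'') mod 3 = 0" "(q + q' + q'') mod 3 = 0"
      have "eval_at w (f * g * h) = eval_at v (f * g * h)"
        by (rule deg3[symmetric], rule semi_invariants_cong[OF semi_invariants_mult[OF semi_invariants_mult[OF f(1) g(1)] h(1)]])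
          (use pq in simp_all)
      with f g h show "(k + k' + k'') mod 3 = 0"
        by (intro e_trivial[of _ "eval_at v (f * g * h)"]) (simp_all add: eval_at.hom_mult e_add mult_ac)
    next
      assume pq: "(p + p' + 2 * p'') mod 3 = 0" "(q + q' + 2 * q'') mod 3 = 0"
      have "eval_at w (f * g * (h * h)) = eval_at v (f * g * (h * h))"
        by (rule agree_in_degree_4[symmetric, OF v w sym deg3 f(1) g(1) h(1) pq])
      moreover have "e (k + k' + 2 * k'') = e k * e k' * (e k'' * e k'')"
        by (simp only: mult_2 e_add)
      ultimately show "(k + k' + 2 * k'') mod 3 = 0" using f g h
        by (intro e_trivial[of _ "eval_at v (f * g * (h * h))"]) (simp_all add: eval_at.hom_mult mult_ac)
    }
  next
    fix i j assume "\<And>p q k. (p, q, k) \<in> S \<Longrightarrow> (k - (p * i + q * j)) mod 3 = 0"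
    then show thesis by (rule that)
  qed
  \<comment> \<open>Matrix powers take natural exponents, so the integers \<open>i\<close> and
    \<open>j\<close> are replaced by their residues.\<close>
  define i' where "i' = nat (i mod 3)"
  define j' where "j' = nat (j mod 3)"
  have "w = A ^\<^sub>m i' *\<^sub>v (B ^\<^sub>m j' *\<^sub>v v)"
  proof (rule eq_if_weight_spaces[OF w])
    have Bv: "B ^\<^sub>m j' *\<^sub>v v \<in> carrier_vec n"
      by (rule mult_mat_vec_carrier[OF pow_carrier_mat[OF B] v])
    then show "A ^\<^sub>m i' *\<^sub>v (B ^\<^sub>m j' *\<^sub>v v) \<in> carrier_vec n"
      by (rule mult_mat_vec_carrier[OF pow_carrier_mat[OF A]])
    fix p q u assume u: "u \<in> weight_space p q"
    then have u': "u \<in> carrier_vec n" "transpose_mat A *\<^sub>v u = e p \<cdot>\<^sub>v u" "transpose_mat B *\<^sub>v u = e q \<cdot>\<^sub>v u"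
      by (auto simp: weight_space_def)
    have "e (int i' * p) * e (int j' * q) = e (p * i + q * j)"
      unfolding i'_def j'_def e_add[symmetric]
      by (intro e_cong mod_add_cong) (simp_all add: mod_simps mult.commute)
    then have rhs: "u \<bullet> (A ^\<^sub>m i' *\<^sub>v (B ^\<^sub>m j' *\<^sub>v v)) = e (p * i + q * j) * (u \<bullet> v)"
      by (simp add: scalar_prod_pow[OF A u'(1,2) Bv] scalar_prod_pow[OF B u'(1,3) v] flip: mult.assoc)
    let ?f = "linear_form n u"
    note f = linear_form_semi_invariant[OF u]
    have "eval_at v (?f * ?f * ?f) = eval_at w (?f * ?f * ?f)"
      by (rule deg3, rule semi_invariants_cong[OF semi_invariants_mult[OF semi_invariants_mult[OF f f] f]]) simp_all
    \<comment> \<open>Equal cubes also settle the forms vanishing at \<open>v\<close>, which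
      \<open>S\<close> leaves out.\<close>
    then have cubes: "(u \<bullet> w) ^ 3 = (u \<bullet> v) ^ 3"
      using v w by (simp add: eval_at.hom_mult eval_at_linear_form power3_eq_cube)
    show "u \<bullet> w = u \<bullet> (A ^\<^sub>m i' *\<^sub>v (B ^\<^sub>m j' *\<^sub>v v))"
    proof (cases "u \<bullet> v = 0")
      case True
      then show ?thesis using cubes rhs by simp
    next
      case False
      then have "((u \<bullet> w) / (u \<bullet> v)) ^ 3 = 1" using cubes by (simp add: power_divide)
      then obtain k where "(u \<bullet> w) / (u \<bullet> v) = e k" by (rule cube_root_of_unity_cases)
      then have k: "u \<bullet> w = e k * (u \<bullet> v)" using False by (simp add: field_simps)
      then have "(k - (p * i + q * j)) mod 3 = 0"
        using False u by (intro ij) (auto simp: S_def)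
      then have "e k = e (p * i + q * j)" by (intro e_cong) presburger
      then show ?thesis using k rhs by simp
    qed
  qed
  then show ?thesis by (rule that)
qed

text \<open>Let \<open>D f x = f x - f (C x)\<close>. If \<open>f\<close> and \<open>g\<close> are invariants of \<open>A\<close> and \<open>B\<close> of degree at most
  three, then \<open>D f x * D g x\<close> is the value at \<open>x\<close> of an invariant of degree at most six. So the
  families \<open>D _ v\<close> and \<open>D _ w\<close> agree up to a common sign, which \<open>C\<close> absorbs.\<close>

lemma separation:
  assumes v: "v \<in> carrier_vec n" and w: "w \<in> carrier_vec n"
    and inv: "\<And>f. f \<in> polys_upto n 6 \<Longrightarrow> compose_linear A f = f \<Longrightarrow> compose_linear B f = f \<Longrightarrow>
      compose_linear C f = f \<Longrightarrow> eval_at v f = eval_at w f"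
  obtains i j where "w = A ^\<^sub>m i *\<^sub>v (B ^\<^sub>m j *\<^sub>v v) \<or> C *\<^sub>v w = A ^\<^sub>m i *\<^sub>v (B ^\<^sub>m j *\<^sub>v v)"
proof -
  have sym: "eval_at v f + eval_at (C *\<^sub>v v) f = eval_at w f + eval_at (C *\<^sub>v w) f"
    if f: "f \<in> semi_invariants 0 0 6" for f
  proof -
    note f' = semi_invariants_conj[OF f]
    \<comment> \<open>The identity matrix is both the square of \<open>C\<close> and the cube of
      \<open>A\<close>, and \<open>f\<close> is known to be fixed by \<open>A\<close>.\<close>
    have "compose_linear C (compose_linear C f) = compose_linear (A * (A * A)) f"
      using compose_linear_compose_linear[OF C C semi_invariants_coord_ring[OF f]] CC AAA by simp
    also have "\<dots> = compose_linear (A * A) (compose_linear A f)"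
      using A semi_invariants_coord_ring[OF f] by (intro compose_linear_compose_linear[symmetric]) auto
    also have "\<dots> = f"
      using f compose_linear_compose_linear[OF A A semi_invariants_coord_ring[OF f]]
      by (simp add: semi_invariants_def e_0 Const.hom_1)
    finally have "eval_at v (f + compose_linear C f) = eval_at w (f + compose_linear C f)"
      using f f'
      by (intro inv) (auto simp: semi_invariants_def e_0 Const.hom_1 compose_linear.hom_add
          polys_upto_add add.commute)
    then show ?thesis
      by (simp add: eval_at.hom_add eval_at_conj[OF f v] eval_at_conj[OF f w])
  qed
  define D where "D f x = eval_at x f - eval_at (C *\<^sub>v x) f" for f x
  have D: "D f v * D g v = D f w * D g w"
    if f: "f \<in> semi_invariants 0 0 3" and g: "g \<in> semi_invariants 0 0 3" for f g
  proof -
    note g' = semi_invariants_conj[OF g]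
    have fg: "f * g \<in> semi_invariants 0 0 6" "f * compose_linear C g \<in> semi_invariants 0 0 6"
      using semi_invariants_mult[OF f g] semi_invariants_mult[OF f g'] by simp_all
    show ?thesis
      using sym[OF fg(1)] sym[OF fg(2)]
      by (simp add: D_def eval_at.hom_mult eval_at_conj[OF g] v w Cx CCx algebra_simps)
  qed
  \<comment> \<open>Twice a value is its symmetric part, governed by \<open>sym\<close>, plus its
    antisymmetric part \<open>D\<close>.\<close>
  have from_D: "eval_at v f = eval_at x f"
    if f: "f \<in> semi_invariants 0 0 3" and "D f v = D f x"
      and "eval_at x f + eval_at (C *\<^sub>v x) f = eval_at w f + eval_at (C *\<^sub>v w) f" for f x
  proof -
    have "eval_at v f + eval_at (C *\<^sub>v v) f = eval_at x f + eval_at (C *\<^sub>v x) f"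
      using sym[OF semi_invariants_cong[OF f]] that(3) by simp
    moreover have "2 * eval_at y f = (eval_at y f + eval_at (C *\<^sub>v y) f) + D f y" for y
      by (simp add: D_def)
    ultimately have "2 * eval_at v f = 2 * eval_at x f"
      using that(2) by metis
    then show ?thesis using two_neq_0 by simp
  qed
  show ?thesis
  proof (cases "\<forall>f\<in>semi_invariants 0 0 3. D f v = D f w")
    case True
    have "eval_at v f = eval_at w f" if "f \<in> semi_invariants 0 0 3" for f
      by (rule from_D[OF that]) (use True that in simp_all)
    then obtain i j where "w = A ^\<^sub>m i *\<^sub>v (B ^\<^sub>m j *\<^sub>v v)"
      using translate_if_agree_in_degree_3[OF v w sym] by blast
    then show ?thesis by (intro that[of i j]) simp
  next
    case False
    then obtain f where f: "f \<in> semi_invariants 0 0 3" "D f v \<noteq> D f w" by blast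
    \<comment> \<open>Pairing \<open>f\<close> with itself gives equal squares, hence opposite
      values, nonzero because they differ. Pairing \<open>f\<close> with any \<open>g\<close> then
      forces the same sign on \<open>g\<close>.\<close>
    with D[OF f(1) f(1)] have neg: "D f v = - D f w"
      by (simp add: square_eq_iff)
    have "D g v = - D g w" if g: "g \<in> semi_invariants 0 0 3" for g
    proof -
      have "D f w \<noteq> 0" using f neg by auto
      moreover have "D f w * D g v = D f w * - D g w"
        using D[OF f(1) g] neg by (metis minus_minus mult_minus_left mult_minus_right)
      ultimately show ?thesis by (metis mult_left_cancel)
    qed
    \<comment> \<open>\<open>C\<close> exchanges the two terms of \<open>D g\<close>, so replacing
      \<open>w\<close> by its image under \<open>C\<close> absorbs the sign.\<close>
    then have *: "D g v = D g (C *\<^sub>v w)" if "g \<in> semi_invariants 0 0 3" for g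
      using that w by (simp add: D_def CCx)
    have "eval_at v g = eval_at (C *\<^sub>v w) g" if "g \<in> semi_invariants 0 0 3" for g
      by (rule from_D[OF that *[OF that]]) (simp add: CCx w add.commute)
    moreover have "eval_at v g + eval_at (C *\<^sub>v v) g =
        eval_at (C *\<^sub>v w) g + eval_at (C *\<^sub>v (C *\<^sub>v w)) g" if "g \<in> semi_invariants 0 0 6" for g
      using sym[OF that] by (simp add: CCx w add.commute)
    ultimately obtain i j where "C *\<^sub>v w = A ^\<^sub>m i *\<^sub>v (B ^\<^sub>m j *\<^sub>v v)"
      using translate_if_agree_in_degree_3[OF v Cx[OF w]] by blast
    then show ?thesis by (intro that[of i j]) simp
  qed
qed

end

section \<open>The upper bound\<close>

abbreviation H :: "((int \<times> int) \<times> int) monoid" where "H \<equiv> C3xC3_rtimes_C2"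

locale C3xC3_rtimes_C2_rep = cube_root \<omega> for \<omega> :: "'k::field" +
  fixes n :: nat and \<rho> :: "(int \<times> int) \<times> int \<Rightarrow> 'k mat"
  assumes rep: "matrix_rep H n \<rho>"
begin

interpretation H: group H
  by (rule group_C3xC3_rtimes_C2)

lemma rho_carrier: "g \<in> carrier H \<Longrightarrow> \<rho> g \<in> carrier_mat n n"
  and rho_one: "\<rho> \<one>\<^bsub>H\<^esub> = 1\<^sub>m n"
  and rho_mult: "g \<in> carrier H \<Longrightarrow> h \<in> carrier H \<Longrightarrow> \<rho> (g \<otimes>\<^bsub>H\<^esub> h) = \<rho> g * \<rho> h"
  using rep by (simp_all add: matrix_rep_def)

lemma generators_in_carrier:
  "((1,0),0) \<in> carrier H" "((0,1),0) \<in> carrier H" "((0,0),1) \<in> carrier H"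
  by (simp_all add: carrier_C3xC3_rtimes_C2)

sublocale generator_matrices \<omega> n "\<rho> ((1,0),0)" "\<rho> ((0,1),0)" "\<rho> ((0,0),1)"
proof unfold_locales
  have *: "\<rho> ((i,j),k) * \<rho> ((i',j'),k') = \<rho> (((i,j),k) \<otimes>\<^bsub>H\<^esub> ((i',j'),k'))"
    if "((i,j),k) \<in> carrier H" "((i',j'),k') \<in> carrier H" for i j k i' j' k'
    using rho_mult[OF that] by simp
  have a2: "\<rho> ((1,0),0) * \<rho> ((1,0),0) = \<rho> ((2,0),0)"
    and b2: "\<rho> ((0,1),0) * \<rho> ((0,1),0) = \<rho> ((0,2),0)"
    and ac: "\<rho> ((1,0),0) * \<rho> ((0,0),1) = \<rho> ((1,0),1)"
    and bc: "\<rho> ((0,1),0) * \<rho> ((0,0),1) = \<rho> ((0,1),1)"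
    by (subst *; simp add: carrier_C3xC3_rtimes_C2 mult_C3xC3_rtimes_C2)+
  show "\<rho> ((1,0),0) * (\<rho> ((1,0),0) * \<rho> ((1,0),0)) = 1\<^sub>m n"
    "\<rho> ((0,1),0) * (\<rho> ((0,1),0) * \<rho> ((0,1),0)) = 1\<^sub>m n"
    "\<rho> ((0,0),1) * \<rho> ((0,0),1) = 1\<^sub>m n"
    "\<rho> ((1,0),0) * \<rho> ((0,1),0) = \<rho> ((0,1),0) * \<rho> ((1,0),0)"
    "\<rho> ((0,0),1) * \<rho> ((1,0),0) = \<rho> ((1,0),0) * (\<rho> ((1,0),0) * \<rho> ((0,0),1))"
    "\<rho> ((0,0),1) * \<rho> ((0,1),0) = \<rho> ((0,1),0) * (\<rho> ((0,1),0) * \<rho> ((0,0),1))"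
    unfolding a2 b2 ac bc using rho_one
    by (simp_all add: * carrier_C3xC3_rtimes_C2 mult_C3xC3_rtimes_C2 one_C3xC3_rtimes_C2)
qed (simp_all add: rho_carrier generators_in_carrier)

text \<open>The elements fixing \<open>f\<close> form a subgroup, so it is enough to test
  generators.\<close>

lemma invariant_if_generators:
  assumes f: "f \<in> coord_ring n"
    and gens: "compose_linear (\<rho> ((1,0),0)) f = f" "compose_linear (\<rho> ((0,1),0)) f = f"
      "compose_linear (\<rho> ((0,0),1)) f = f"
    and g: "g \<in> carrier H"
  shows "compose_linear (\<rho> g) f = f"
proof -
  note gen = generators_in_carrier
  have comp: "compose_linear (\<rho> (g \<otimes>\<^bsub>H\<^esub> h)) f = compose_linear (\<rho> h) (compose_linear (\<rho> g) f)"
    if "g \<in> carrier H" "h \<in> carrier H" for g h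
    using that f by (simp add: rho_mult compose_linear_compose_linear[of _ n] rho_carrier)
  \<comment> \<open>Writing the identity as the square of the generator c derives its action on
    \<open>f\<close> from the generators.\<close>
  have one: "compose_linear (\<rho> \<one>\<^bsub>H\<^esub>) f = f"
  proof -
    have "\<one>\<^bsub>H\<^esub> = ((0,0),1) \<otimes>\<^bsub>H\<^esub> ((0,0),1)"
      by (simp add: mult_C3xC3_rtimes_C2 one_C3xC3_rtimes_C2)
    then show ?thesis using comp[OF gen(3) gen(3)] gens by simp
  qed
  have "g \<in> generate H {((1,0),0), ((0,1),0), ((0,0),1)}"
    using g presentation_C3xC3_rtimes_C2(7) by simp
  then have "g \<in> carrier H \<and> compose_linear (\<rho> g) f = f"
  proof (induction rule: generate.induct)
    case one
    show ?case using \<open>compose_linear (\<rho> \<one>\<^bsub>H\<^esub>) f = f\<close> by simp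
  next
    case (incl h)
    then show ?case using gen gens by auto
  next
    case (inv h)
    then have h: "h \<in> carrier H" "compose_linear (\<rho> h) f = f" using gen gens by auto
    then show ?case using comp[of h "inv\<^bsub>H\<^esub> h"] one by simp
  next
    case (eng h1 h2)
    then show ?case using comp by simp
  qed
  then show ?thesis by simp
qed

text \<open>One inclusion holds for every \<open>g\<close>; applied to the inverse of
  \<open>g\<close> it gives the other.\<close>

lemma vec_orbit_eqI:
  assumes v: "v \<in> carrier_vec n" and g: "g \<in> carrier H"
  shows "vec_orbit H \<rho> (\<rho> g *\<^sub>v v) = vec_orbit H \<rho> v"
proof -
  have sub: "vec_orbit H \<rho> (\<rho> g *\<^sub>v v) \<subseteq> vec_orbit H \<rho> v"
    if "v \<in> carrier_vec n" "g \<in> carrier H" for v g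
  proof
    fix x assume "x \<in> vec_orbit H \<rho> (\<rho> g *\<^sub>v v)"
    then obtain h where h: "h \<in> carrier H" "x = \<rho> h *\<^sub>v (\<rho> g *\<^sub>v v)"
      by (auto simp: vec_orbit_eq_image)
    then have "x = \<rho> (h \<otimes>\<^bsub>H\<^esub> g) *\<^sub>v v"
      using that by (simp add: rho_mult assoc_mult_mat_vec[OF rho_carrier rho_carrier])
    then show "x \<in> vec_orbit H \<rho> v"
      using h that by (auto simp: vec_orbit_eq_image)
  qed
  have "\<rho> (inv\<^bsub>H\<^esub> g) *\<^sub>v (\<rho> g *\<^sub>v v) = \<rho> (inv\<^bsub>H\<^esub> g \<otimes>\<^bsub>H\<^esub> g) *\<^sub>v v"
    using v g rho_mult[of "inv\<^bsub>H\<^esub> g" g] assoc_mult_mat_vec[OF rho_carrier rho_carrier v]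
    by (metis H.inv_closed)
  also have "\<dots> = v"
    using v g by (simp add: rho_one)
  finally have "\<rho> (inv\<^bsub>H\<^esub> g) *\<^sub>v (\<rho> g *\<^sub>v v) = v" .
  then show ?thesis
    using sub[OF v g] sub[of "\<rho> g *\<^sub>v v" "inv\<^bsub>H\<^esub> g"] rho_carrier[OF g] v g by auto
qed

lemma pow_in_image:
  assumes "g \<in> carrier H"
  obtains h where "h \<in> carrier H" "\<rho> g ^\<^sub>m k = \<rho> h"
proof -
  have "\<exists>h\<in>carrier H. \<rho> g ^\<^sub>m k = \<rho> h"
  proof (induction k)
    case 0
    then show ?case
      using rho_carrier[OF assms] rho_one H.one_closed by (metis carrier_matD(1) pow_mat.simps(1))
  next
    case (Suc k)
    then show ?case
      using rho_mult[OF _ assms] H.m_closed[OF _ assms] by (metis pow_mat.simps(2))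
  qed
  then show ?thesis using that by blast
qed

text \<open>By \<open>separation\<close>, \<open>w\<close> or its image under c is a translate of
  \<open>v\<close> by the normal subgroup, and these two points share an orbit.\<close>

lemma same_orbit:
  assumes v: "v \<in> carrier_vec n" and w: "w \<in> carrier_vec n"
    and inv: "\<And>f. f \<in> invariant_ring H n \<rho> \<Longrightarrow> total_degree f \<le> 6 \<Longrightarrow> eval_at v f = eval_at w f"
  shows "vec_orbit H \<rho> v = vec_orbit H \<rho> w"
proof -
  note gen = generators_in_carrier
  obtain i j where ij: "w = \<rho> ((1,0),0) ^\<^sub>m i *\<^sub>v (\<rho> ((0,1),0) ^\<^sub>m j *\<^sub>v v) \<or>
      \<rho> ((0,0),1) *\<^sub>v w = \<rho> ((1,0),0) ^\<^sub>m i *\<^sub>v (\<rho> ((0,1),0) ^\<^sub>m j *\<^sub>v v)"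
  proof (rule separation[OF v w])
    fix f assume f: "f \<in> polys_upto n 6" "compose_linear (\<rho> ((1,0),0)) f = f"
      "compose_linear (\<rho> ((0,1),0)) f = f" "compose_linear (\<rho> ((0,0),1)) f = f"
    then show "eval_at v f = eval_at w f"
      using invariant_if_generators[of f]
      by (intro inv) (simp_all add: invariant_ring_iff[OF group_C3xC3_rtimes_C2] polys_upto_def)
  qed
  obtain g where g: "g \<in> carrier H" "\<rho> ((1,0),0) ^\<^sub>m i = \<rho> g" by (rule pow_in_image[OF gen(1)])
  obtain h where h: "h \<in> carrier H" "\<rho> ((0,1),0) ^\<^sub>m j = \<rho> h" by (rule pow_in_image[OF gen(2)])
  have "vec_orbit H \<rho> (\<rho> g *\<^sub>v (\<rho> h *\<^sub>v v)) = vec_orbit H \<rho> v"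
    using vec_orbit_eqI[OF _ g(1)] vec_orbit_eqI[OF v h(1)] rho_carrier[OF h(1)] v by simp
  then show ?thesis
    using ij vec_orbit_eqI[OF w gen(3)] unfolding g(2) h(2) by auto
qed

lemma beta_sep_rep_le: "beta_sep_rep H n \<rho> \<le> 6"
proof -
  have "separating_set H n \<rho> {f \<in> invariant_ring H n \<rho>. total_degree f \<le> 6}"
    unfolding separating_set_def using same_orbit by blast
  then have "enat 6 \<in> enat ` {d. 0 < d \<and>
      separating_set H n \<rho> {f \<in> invariant_ring H n \<rho>. total_degree f \<le> d}}"
    by simp
  then show ?thesis
    unfolding beta_sep_rep_def by (subst numeral_eq_enat) (rule Inf_lower)
qed

end

section \<open>The lower bound\<close>

lemma monom_val_Var: "monom_val Var m = (Poly_Mapping.single m 1 :: 'k::comm_semiring_1 mpoly)"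
proof -
  have pow: "Var i ^ k = (Poly_Mapping.single (Poly_Mapping.single i k) 1 :: 'k mpoly)" for i k
    by (induction k) (simp_all add: Var_def mult_single flip: single_add)
  have "(\<Prod>i\<in>I. Poly_Mapping.single (p i) 1) = (Poly_Mapping.single (sum p I) 1 :: 'k mpoly)"
    for I and p :: "nat \<Rightarrow> nat \<Rightarrow>\<^sub>0 nat"
    by (induction I rule: infinite_finite_induct) (simp_all add: mult_single)
  then show ?thesis
    by (simp add: pow flip: poly_mapping_eq_sum_single)
qed

text \<open>A diagonal substitution only rescales monomials. Hence if it fixes \<open>f\<close>, it
  fixes every monomial occurring in \<open>f\<close>.\<close>

lemma lookup_compose_linear_diagonal:
  assumes D: "D \<in> carrier_mat n n" and diag: "\<And>i j. i < n \<Longrightarrow> j < n \<Longrightarrow> i \<noteq> j \<Longrightarrow> D $$ (i, j) = 0"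
    and f: "f \<in> coord_ring n"
  shows "Poly_Mapping.lookup (compose_linear D f) m =
    Poly_Mapping.lookup f m * monom_val (\<lambda>i. D $$ (i, i)) m"
proof -
  have "compose_linear D f = substitute Const (\<lambda>i. Const (D $$ (i, i)) * Var i) f"
    unfolding compose_linear_def
  proof (rule substitute_cong[OF f])
    fix i assume i: "i < n"
    have "(\<Sum>j<dim_col D. Const (D $$ (i, j)) * Var j) =
        (\<Sum>j<n. if j = i then Const (D $$ (i, i)) * Var i else 0)"
      using D diag i by (intro sum.cong) (auto simp: Const_def)
    then show "(\<Sum>j<dim_col D. Const (D $$ (i, j)) * Var j) = Const (D $$ (i, i)) * Var i"
      using i by simp
  qed
  also have "\<dots> = (\<Sum>m\<in>Poly_Mapping.keys f.
      Poly_Mapping.single m (Poly_Mapping.lookup f m * monom_val (\<lambda>i. D $$ (i, i)) m))"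
  proof -
    have "monom_val (\<lambda>i. Const (D $$ (i, i)) * Var i) m =
        Const (monom_val (\<lambda>i. D $$ (i, i)) m) * monom_val Var m" for m
      by (simp add: power_mult_distrib prod.distrib Const.hom_prod Const.hom_power)
    then show ?thesis
      unfolding substitute_def monom_val_Var by (simp add: Const_def mult_single)
  qed
  finally show ?thesis
    by (simp add: lookup_sum lookup_single when_def in_keys_iff sum.delta)
qed

definition indicator_vec :: "nat \<Rightarrow> nat set \<Rightarrow> 'k::zero_neq_one vec" where
  "indicator_vec n T = vec n (\<lambda>i. if i \<in> T then 1 else 0)"

lemma indicator_vec_carrier: "indicator_vec n T \<in> carrier_vec n"
  by (simp add: indicator_vec_def)

text \<open>At a vector of zeros and ones a monomial has value one if all its variables lie in
  \<open>T\<close>, and zero otherwise. The constant monomial survives for every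
  \<open>T\<close>.\<close>

lemma eval_at_indicator_vec:
  fixes f :: "'k::comm_semiring_1 mpoly"
  assumes f: "f \<in> coord_ring n"
  shows "eval_at (indicator_vec n T) f =
    (\<Sum>m\<in>Poly_Mapping.keys f. if Poly_Mapping.keys m \<subseteq> T then Poly_Mapping.lookup f m else 0)"
proof -
  have "monom_val (\<lambda>i. indicator_vec n T $ i) m = (if Poly_Mapping.keys m \<subseteq> T then 1 else 0 :: 'k)"
    if "m \<in> Poly_Mapping.keys f" for m
  proof -
    have sub: "Poly_Mapping.keys m \<subseteq> {..<n}" using f that by (auto simp: coord_ring_def)
    show ?thesis
    proof (cases "Poly_Mapping.keys m \<subseteq> T")
      case True
      then show ?thesis using sub by (auto simp: indicator_vec_def subset_eq intro!: prod.neutral)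
    next
      case False
      then obtain i where "i \<in> Poly_Mapping.keys m" "i \<notin> T" by blast
      then have "\<exists>i\<in>Poly_Mapping.keys m. indicator_vec n T $ i ^ Poly_Mapping.lookup m i = (0::'k)"
        using sub by (intro bexI[of _ i]) (auto simp: indicator_vec_def subset_eq in_keys_iff zero_power)
      then have "monom_val (\<lambda>i. indicator_vec n T $ i) m = (0::'k)"
        by (intro prod_zero) simp_all
      then show ?thesis using False by simp
    qed
  qed
  then show ?thesis
    unfolding eval_at_def substitute_def by (intro sum.cong) auto
qed

section \<open>The four-dimensional module attaining the bound\<close>

context cube_root
begin

text \<open>Indices 0, 1, 2, 3 stand for the coordinates x1, y1, x2, y2; the element c exchanges the
  two members of each pair.\<close>

definition swap_index :: "nat \<Rightarrow> nat" where
  "swap_index r = (if r = 0 then 1 else if r = 1 then 0 else if r = 2 then 3 else 2)"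

definition weight :: "int \<Rightarrow> int \<Rightarrow> nat \<Rightarrow> int" where
  "weight i j r = (if r = 0 then i else if r = 1 then - i else if r = 2 then j else - j)"

text \<open>The sum of the two-dimensional modules induced from the characters \<open>a \<mapsto> \<omega>, b \<mapsto> 1\<close> and
  \<open>a \<mapsto> 1, b \<mapsto> \<omega>\<close>.\<close>

definition induced_rep :: "(int \<times> int) \<times> int \<Rightarrow> 'k mat" where
  "induced_rep = (\<lambda>((i, j), k). mat 4 4 (\<lambda>(r, s).
     if s = (if k = 0 then r else swap_index r) then e (weight i j r) else 0))"

lemma less_4_cases: fixes r :: nat assumes "r < 4" obtains "r = 0" | "r = 1" | "r = 2" | "r = 3"
  using assms by linarith

lemma matrix_rep_induced_rep: "matrix_rep H 4 induced_rep"
  unfolding matrix_rep_def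
proof (intro conjI ballI)
  show "induced_rep g \<in> carrier_mat 4 4" for g
    by (auto simp: induced_rep_def split: prod.split)
  show "induced_rep \<one>\<^bsub>H\<^esub> = 1\<^sub>m 4"
    by (rule eq_matI) (auto simp: induced_rep_def one_C3xC3_rtimes_C2 weight_def e_0)
  fix g h assume "g \<in> carrier H" "h \<in> carrier H"
  then obtain i j k i' j' k' where gh: "g = ((i, j), k)" "h = ((i', j'), k')"
    and k: "k = 0 \<or> k = 1" "k' = 0 \<or> k' = 1" and ij: "i' \<in> {0,1,2}" "j' \<in> {0,1,2}"
    unfolding carrier_C3xC3_rtimes_C2 by (elim SigmaE) simp
  show "induced_rep (g \<otimes>\<^bsub>H\<^esub> h) = induced_rep g * induced_rep h"
  proof (rule eq_matI)
    fix r s assume "r < dim_row (induced_rep g * induced_rep h)" "s < dim_col (induced_rep g * induced_rep h)"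
    then have rs: "r < 4" "s < 4" by (auto simp: induced_rep_def gh)
    define t where "t = (if k = 0 then r else swap_index r)"
    have t: "t < 4" using rs by (simp add: t_def swap_index_def)
    have "(induced_rep g * induced_rep h) $$ (r, s) =
        (\<Sum>l\<in>{0..<4}. (if l = t then e (weight i j r) else 0) * induced_rep h $$ (l, s))"
      using rs by (simp add: induced_rep_def gh scalar_prod_def t_def)
    also have "\<dots> = (\<Sum>l\<in>{0..<4}. if l = t then e (weight i j r) * induced_rep h $$ (l, s) else 0)"
      by (intro sum.cong) auto
    also have "\<dots> = e (weight i j r) * induced_rep h $$ (t, s)"
      using t by simp
    also have "\<dots> = (if s = (if k' = 0 then t else swap_index t)
        then e (weight i j r + weight i' j' t) else 0)"
      using rs t by (simp add: induced_rep_def gh e_add)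
    also have "(if k' = 0 then t else swap_index t) = (if (k + k') mod 2 = 0 then r else swap_index r)"
      using k rs(1) by (auto simp: t_def swap_index_def)
    also have "e (weight i j r + weight i' j' t) = e (weight (fst (fst (g \<otimes>\<^bsub>H\<^esub> h))) (snd (fst (g \<otimes>\<^bsub>H\<^esub> h))) r)"
      unfolding gh mult_C3xC3_rtimes_C2[OF ij]
      by (intro e_cong, rule less_4_cases[OF rs(1)])
        (use k(1) in \<open>auto simp: weight_def t_def swap_index_def mod_simps minus_diff_commute\<close>)
    finally show "induced_rep (g \<otimes>\<^bsub>H\<^esub> h) $$ (r, s) = (induced_rep g * induced_rep h) $$ (r, s)"
      using rs unfolding gh mult_C3xC3_rtimes_C2[OF ij] by (auto simp: induced_rep_def split: if_splits)
  qed (auto simp: induced_rep_def gh split: prod.splits)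
qed

text \<open>A monomial containing both variables has two positive exponents divisible by three,
  hence degree at least six. Below that degree inclusion-exclusion applies; the last term corrects
  for the constant monomial, counted twice.\<close>

lemma low_degree_invariant_additive:
  assumes f: "f \<in> invariant_ring H 4 induced_rep" and deg: "total_degree f \<le> 5"
    and s: "s = 2 \<or> s = 3"
  shows "eval_at (indicator_vec 4 {0, s}) f =
    eval_at (indicator_vec 4 {0}) f + eval_at (indicator_vec 4 {s}) f - eval_at (indicator_vec 4 {}) f"
proof -
  have coord: "f \<in> coord_ring 4" and inv: "\<And>g. g \<in> carrier H \<Longrightarrow> compose_linear (induced_rep g) f = f"
    using f by (auto simp: invariant_ring_iff[OF group_C3xC3_rtimes_C2])
  have split: "Poly_Mapping.keys m \<subseteq> {0} \<or> Poly_Mapping.keys m \<subseteq> {s}"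
    if m: "m \<in> Poly_Mapping.keys f" and sub: "Poly_Mapping.keys m \<subseteq> {0, s}" for m
  proof -
    have char: "e (int (Poly_Mapping.lookup m 0) * weight i j 0 + int (Poly_Mapping.lookup m s) * weight i j s) = 1"
      if ij: "i \<in> {0,1,2}" "j \<in> {0,1,2}" for i j
    proof -
      let ?D = "induced_rep ((i, j), 0)"
      have "Poly_Mapping.lookup (compose_linear ?D f) m = Poly_Mapping.lookup f m * monom_val (\<lambda>i. ?D $$ (i, i)) m"
        by (rule lookup_compose_linear_diagonal[OF _ _ coord]) (auto simp: induced_rep_def)
      moreover have "compose_linear ?D f = f"
        using ij by (intro inv) (simp only: carrier_C3xC3_rtimes_C2 mem_Times_iff, simp)
      ultimately have "monom_val (\<lambda>i. ?D $$ (i, i)) m = 1"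
        using m by (simp add: in_keys_iff)
      then show ?thesis
        using s by (subst (asm) monom_val_superset[OF _ sub])
          (auto simp: induced_rep_def e_add e_mult_nat)
    qed
    \<comment> \<open>The generator a acts only on coordinate 0 of the two and b only on coordinate
      \<open>s\<close>, so each isolates one exponent.\<close>
    have "int (Poly_Mapping.lookup m 0) mod 3 = 0" "int (Poly_Mapping.lookup m s) mod 3 = 0"
      using char[of 1 0] char[of 0 1] s unfolding e_eq_1_iff
      by (auto simp: weight_def)
    moreover have "Poly_Mapping.lookup m 0 + Poly_Mapping.lookup m s \<le> 5"
    proof -
      have "f \<in> polys_upto 4 5" using coord deg by (simp add: polys_upto_def)
      then have "monom_deg m \<le> 5" using m by (simp add: polys_upto_iff)
      then show ?thesis using s by (subst (asm) monom_deg_superset[OF _ sub]) auto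
    qed
    ultimately have "Poly_Mapping.lookup m 0 = 0 \<or> Poly_Mapping.lookup m s = 0"
      by presburger
    then show ?thesis using sub by (auto simp: in_keys_iff)
  qed
  have "(if Poly_Mapping.keys m \<subseteq> {0, s} then c else 0) =
      (if Poly_Mapping.keys m \<subseteq> {0} then c else 0) + (if Poly_Mapping.keys m \<subseteq> {s} then c else 0) -
      (if Poly_Mapping.keys m \<subseteq> {} then c else 0)"
    if m: "m \<in> Poly_Mapping.keys f" for m and c :: 'k
  proof -
    have "Poly_Mapping.keys m \<subseteq> {0, s} \<longleftrightarrow> Poly_Mapping.keys m \<subseteq> {0} \<or> Poly_Mapping.keys m \<subseteq> {s}"
      using split[OF m] by blast
    moreover have "{} = {0} \<inter> {s}" using s by auto
    then have "Poly_Mapping.keys m \<subseteq> {} \<longleftrightarrow> Poly_Mapping.keys m \<subseteq> {0} \<and> Poly_Mapping.keys m \<subseteq> {s}"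
      by (metis Int_subset_iff)
    moreover have "(if P \<or> Q then c else 0) =
        (if P then c else 0) + (if Q then c else 0) - (if P \<and> Q then c else 0)" for P Q
      by simp
    ultimately show ?thesis by presburger
  qed
  then show ?thesis
    unfolding eval_at_indicator_vec[OF coord] sum.distrib[symmetric] sum_subtractf[symmetric]
    by (intro sum.cong refl)
qed

text \<open>The element c exchanges the unit vectors at 2 and 3, so the additive formulas for the
  two points agree term by term.\<close>

lemma low_degree_invariants_agree:
  assumes f: "f \<in> invariant_ring H 4 induced_rep" and deg: "total_degree f \<le> 5"
  shows "eval_at (indicator_vec 4 {0, 2}) f = eval_at (indicator_vec 4 {0, 3}) f"
proof -
  have C: "((0, 0), 1) \<in> carrier H" by (simp add: carrier_C3xC3_rtimes_C2)
  then have inv: "compose_linear (induced_rep ((0, 0), 1)) f = f" and coord: "f \<in> coord_ring 4"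
    using f by (auto simp: invariant_ring_iff[OF group_C3xC3_rtimes_C2])
  have "induced_rep ((0, 0), 1) *\<^sub>v indicator_vec 4 {2} = indicator_vec 4 {3}"
  proof (rule eq_vecI)
    fix r assume "r < dim_vec (indicator_vec 4 {3} :: 'k vec)"
    then have "r < 4" by (simp add: indicator_vec_def)
    then show "(induced_rep ((0, 0), 1) *\<^sub>v indicator_vec 4 {2}) $ r = indicator_vec 4 {3} $ r"
      by (cases r rule: less_4_cases)
        (simp_all add: induced_rep_def indicator_vec_def scalar_prod_def swap_index_def weight_def e_0
          numeral_eq_Suc)
  qed (simp add: induced_rep_def indicator_vec_def)
  moreover have "induced_rep ((0, 0), 1) \<in> carrier_mat 4 4" by (simp add: induced_rep_def)
  ultimately have "eval_at (indicator_vec 4 {2}) f = eval_at (indicator_vec 4 {3}) f"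
    using eval_at_compose_linear[OF _ indicator_vec_carrier coord, of "induced_rep ((0, 0), 1)" "{2}"] inv
    by simp
  then show ?thesis
    using low_degree_invariant_additive[OF f deg, of 2] low_degree_invariant_additive[OF f deg, of 3] by simp
qed

text \<open>The normal subgroup acts diagonally and preserves the support {0, 2}; all other elements
  carry it to {1, 3}. Neither is {0, 3}.\<close>

lemma orbits_differ:
  "vec_orbit H induced_rep (indicator_vec 4 {0, 2}) \<noteq> vec_orbit H induced_rep (indicator_vec 4 {0, 3})"
proof
  assume eq: "vec_orbit H induced_rep (indicator_vec 4 {0, 2}) = vec_orbit H induced_rep (indicator_vec 4 {0, 3})"
  have "indicator_vec 4 {0, 3} \<in> vec_orbit H induced_rep (indicator_vec 4 {0, 3})"
  proof -
    have "induced_rep \<one>\<^bsub>H\<^esub> *\<^sub>v indicator_vec 4 {0, 3} = indicator_vec 4 {0, 3}"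
      using matrix_rep_induced_rep by (simp add: matrix_rep_def indicator_vec_carrier)
    moreover have "\<one>\<^bsub>H\<^esub> \<in> carrier H" by (simp add: one_C3xC3_rtimes_C2 carrier_C3xC3_rtimes_C2)
    ultimately show ?thesis unfolding vec_orbit_eq_image by (metis imageI)
  qed
  then obtain g where g: "g \<in> carrier H" "indicator_vec 4 {0, 3} = induced_rep g *\<^sub>v indicator_vec 4 {0, 2}"
    unfolding eq[symmetric] by (auto simp: vec_orbit_eq_image)
  obtain i j k where ijk: "g = ((i, j), k)" by (metis prod.exhaust)
  have entry: "indicator_vec 4 {0, 3} $ r = (induced_rep g *\<^sub>v indicator_vec 4 {0, 2}) $ r" for r
    using g(2) by simp
  show False
    using entry[of 0] entry[of 3]
    by (cases "k = 0")
      (simp_all add: ijk induced_rep_def indicator_vec_def scalar_prod_def swap_index_def numeral_eq_Suc)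
qed

lemma beta_sep_rep_induced_rep: "6 \<le> beta_sep_rep H 4 induced_rep"
  unfolding beta_sep_rep_def
proof (rule Inf_greatest, elim imageE CollectE conjE)
  fix x d
  assume x: "x = enat d"
    and sep: "separating_set H 4 induced_rep {f \<in> invariant_ring H 4 induced_rep. total_degree f \<le> d}"
  then obtain f where "f \<in> invariant_ring H 4 induced_rep" "total_degree f \<le> d"
      "eval_at (indicator_vec 4 {0, 2}) f \<noteq> eval_at (indicator_vec 4 {0, 3}) f"
    using orbits_differ indicator_vec_carrier unfolding separating_set_def by blast
  then have "\<not> d \<le> 5" using low_degree_invariants_agree by fastforce
  then show "6 \<le> x" unfolding x numeral_eq_enat by simp
qed

lemma beta_sep_C3xC3_rtimes_C2: "beta_sep TYPE('k) H = 6"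
proof (rule antisym)
  show "beta_sep TYPE('k) H \<le> 6"
    unfolding beta_sep_def
  proof (rule Sup_least, elim CollectE exE conjE)
    fix x n and \<rho> :: "_ \<Rightarrow> 'k mat"
    assume x: "x = beta_sep_rep H n \<rho>" and "matrix_rep H n \<rho>"
    then interpret C3xC3_rtimes_C2_rep \<omega> n \<rho> by unfold_locales
    show "x \<le> 6" unfolding x by (rule beta_sep_rep_le)
  qed
  have "beta_sep_rep H 4 induced_rep \<le> beta_sep TYPE('k) H"
    unfolding beta_sep_def using matrix_rep_induced_rep by (intro Sup_upper) blast
  then show "6 \<le> beta_sep TYPE('k) H"
    by (rule order.trans[OF beta_sep_rep_induced_rep])
qed

end

theorem theorem3p2:
  fixes G :: "('g, 'b) monoid_scheme"
  assumes "\<exists>z :: 'k::field. z ^ 6 = 1 \<and> (\<forall>m::nat. 0 < m \<and> m < 6 \<longrightarrow> z ^ m \<noteq> 1)"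
    and "group G"
    and "G \<cong> C3xC3_rtimes_C2"
  shows "beta_sep TYPE('k) G = 6"
proof -
  obtain z :: 'k where z: "z ^ 6 = 1" "\<And>m::nat. 0 < m \<and> m < 6 \<Longrightarrow> z ^ m \<noteq> 1"
    using assms(1) by blast
  \<comment> \<open>The square of an element of order six is a primitive cube root of unity. Its
    cube \<open>z ^ 3\<close> equals -1 and differs from 1, which excludes characteristic
    two.\<close>
  interpret cube_root "z ^ 2"
  proof
    show "(z ^ 2) ^ 3 = 1" using z(1) by (simp flip: power_mult)
    show "z ^ 2 \<noteq> 1" using z(2) by simp
    have "(z ^ 3 - 1) * (z ^ 3 + 1) = z ^ 6 - 1" by (simp add: algebra_simps flip: power_add)
    then have "z ^ 3 + 1 = 0" using z(1) z(2)[of 3] by simp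
    moreover have "z ^ 3 \<noteq> 1" using z(2) by simp
    ultimately show "(2::'k) \<noteq> 0"
      by (metis add_right_cancel one_add_one)
  qed
  show ?thesis
    unfolding beta_sep_iso[OF assms(3,2) group_C3xC3_rtimes_C2] by (rule beta_sep_C3xC3_rtimes_C2)
qed

end
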